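(* Let $S$ be an ordered semigroup satisfying axioms O1–O5. Then $S_{\mathbb{R}}=\mathrm{L}(\mathrm{F}(S))$ (as subsets of $\mathrm{Lsc}(\mathrm{F}(S))$).
   Context: An ordered semigroup is an abelian monoid with a translation invariant order relation in which $0$ is the smallest element. For $s,t$ in an ordered set, $s\ll t$ means: for every increasing sequence $(t_n)$ (having a supremum) with $t\leq \sup_n t_n$ there is $n_0$ with $s\leq t_{n_0}$. Axioms on an ordered semigroup $S$: O1: every increasing sequence has a supremum. O2: every $s\in S$ is the supremum of a sequence $(s_n)$ with $s_n\ll s_{n+1}$ for all $n$. O3: if $s_i\ll t_i$ for $i=1,2$ then $s_1+s_2\ll t_1+t_2$. O4: if $(s_n),(t_n)$ are increasing then $\sup_n(s_n+t_n)=\sup_n s_n+\sup_n t_n$. O5: if $s'\ll s\leq t$ then there exists $r$ with $s'+r\leq t\leq s+r$. A functional on $S$ is a map $\lambda\colon S\to[0,\infty]$ that is additive, order preserving, sends $0$ to $0$, and preserves suprema of increasing sequences. $\mathrm{F}(S)$ is the cone of all functionals (pointwise operations), with the topology in which a net $(\lambda_i)$ converges to $\lambda$ iff $\limsup_i\lambda_i(s')\leq\lambda(s)\leq\liminf_i\lambda_i(s)$ for all $s',s\in S$ with $s'\ll s$. $\mathrm{Lsc}(\mathrm{F}(S))$ is the set of lower semicontinuous functions $f\colon\mathrm{F}(S)\to[0,\infty]$ that are linear (additive, homogeneous for positive real scalars, $f(0)=0$), with pointwise order and operations. For $s\in S$, $\hat s\in\mathrm{Lsc}(\mathrm{F}(S))$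 is $\hat s(\lambda)=\lambda(s)$. $S_{\mathbb{R}}\subseteq \mathrm{Lsc}(\mathrm{F}(S))$ is the set of functions $f$ for which there are $s_i\in S$ and positive integers $n_i$ ($i=1,2,\dots$) such that $(\hat s_i/n_i)_i$ is increasing and $f(\lambda)=\sup_i \hat s_i(\lambda)/n_i$ for all $\lambda\in\mathrm{F}(S)$. For $f,g\in\mathrm{Lsc}(\mathrm{F}(S))$ write $f\lhd g$ if $f\leq(1-\epsilon)g$ for some $\epsilon>0$ and $f$ is continuous at each $\lambda\in\mathrm{F}(S)$ for which $g(\lambda)<\infty$. $\mathrm{L}(\mathrm{F}(S))$ is the set of $f\in\mathrm{Lsc}(\mathrm{F}(S))$ expressible as the (pointwise) supremum of an increasing sequence $(f_n)$ in $\mathrm{Lsc}(\mathrm{F}(S))$ with $f_n\lhd f_{n+1}$ for all $n$. *)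

theory Defs
  imports "HOL-Analysis.Analysis"
begin

context order
begin

definition has_sup :: "(nat \<Rightarrow> 'a) \<Rightarrow> 'a \<Rightarrow> bool"
  where "has_sup x u \<longleftrightarrow> (\<forall>n. x n \<le> u) \<and> (\<forall>v. (\<forall>n. x n \<le> v) \<longrightarrow> u \<le> v)"

text \<open>
  Within a class context \<open>incseq x\<close> is not available; it abbreviates
  \<open>monotone (\<le>) (\<le>) x\<close>.
\<close>

definition way_below :: "'a \<Rightarrow> 'a \<Rightarrow> bool"  (infix \<open>\<lless>\<close> 50)
  where "s \<lless> t \<longleftrightarrow>
    (\<forall>x u. monotone (\<le>) (\<le>) x \<and> has_sup x u \<and> t \<le> u \<longrightarrow> (\<exists>n::nat. s \<le> x n))"

end


text \<open>
  The order is not assumed to be the algebraic one, so the library class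
  \<^class>\<open>canonically_ordered_monoid_add\<close> would be too strong here.
\<close>

class ordered_semigroup = ordered_comm_monoid_add +
  assumes zero_least: "0 \<le> x"

class cu_semigroup = ordered_semigroup +
  assumes O1: "monotone (\<le>) (\<le>) x \<Longrightarrow> \<exists>u. has_sup x u"
    and O2: "\<exists>x. (\<forall>n. x n \<lless> x (Suc n)) \<and> has_sup x s"
    and O3: "s1 \<lless> t1 \<Longrightarrow> s2 \<lless> t2 \<Longrightarrow> s1 + s2 \<lless> t1 + t2"
    and O4: "monotone (\<le>) (\<le>) x \<Longrightarrow> monotone (\<le>) (\<le>) y \<Longrightarrow> has_sup x u \<Longrightarrow> has_sup y v
               \<Longrightarrow> has_sup (\<lambda>n. x n + y n) (u + v)"
    and O5: "s' \<lless> s \<Longrightarrow> s \<le> t \<Longrightarrow> \<exists>r. s' + r \<le> t \<and> t \<le> s + r"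


definition is_functional :: "('a::ordered_semigroup \<Rightarrow> ennreal) \<Rightarrow> bool"
  where "is_functional l \<longleftrightarrow>
    (\<forall>s t. l (s + t) = l s + l t) \<and> mono l \<and> l 0 = 0 \<and>
    (\<forall>t u. incseq t \<and> has_sup t u \<longrightarrow> l u = (SUP n. l (t n)))"

lemma is_functional_zero: "is_functional (\<lambda>_. 0)"
  by (simp add: is_functional_def mono_def)

lemma is_functional_add:
  assumes "is_functional l" "is_functional m"
  shows "is_functional (\<lambda>s. l s + m s)"
proof -
  have "l u + m u = (SUP n. l (t n) + m (t n))" if "incseq t" "has_sup t u" for t u
  proof -
    have "incseq (\<lambda>n. l (t n))" "incseq (\<lambda>n. m (t n))"
      using assms that(1) by (auto simp: is_functional_def mono_def)
    then have "(SUP n. l (t n) + m (t n)) = (SUP n. l (t n)) + (SUP n. m (t n))"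
      by (rule ennreal_SUP_add)
    then show ?thesis
      using assms that by (simp add: is_functional_def)
  qed
  then show ?thesis
    using assms by (auto simp: is_functional_def mono_def add_mono ac_simps)
qed

lemma is_functional_scale:
  assumes "is_functional l"
  shows "is_functional (\<lambda>s. ennreal c * l s)"
  using assms by (auto simp: is_functional_def mono_def distrib_left SUP_mult_left_ennreal
      intro!: mult_left_mono)

text \<open>The cone F(S), with S the type \<^typ>\<open>'a\<close>.\<close>

typedef (overloaded) ('a::ordered_semigroup) functional =
  "{l :: 'a \<Rightarrow> ennreal. is_functional l}"
  morphisms apply_functional Functional
  using is_functional_zero by blast

setup_lifting type_definition_functional

instantiation functional :: (ordered_semigroup) "{zero, plus}"
begin

lift_definition zero_functional :: "'a functional" is "\<lambda>_. 0"
  by (rule is_functional_zero)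

lift_definition plus_functional :: "'a functional \<Rightarrow> 'a functional \<Rightarrow> 'a functional"
  is "\<lambda>l m s. l s + m s"
  by (rule is_functional_add)

instance ..

end

text \<open>Only used with a positive real factor.\<close>

lift_definition scale_functional ::
    "real \<Rightarrow> 'a::ordered_semigroup functional \<Rightarrow> 'a functional"
  is "\<lambda>c l s. ennreal c * l s"
  by (rule is_functional_scale)


text \<open>
  Convergence in F(S), stated for filters instead of nets: the filter \<open>F\<close> is the eventuality
  filter of the net.
\<close>

definition functional_converges ::
    "'a::ordered_semigroup functional filter \<Rightarrow> 'a functional \<Rightarrow> bool"
  where "functional_converges F l \<longleftrightarrow>
    (\<forall>s' s. s' \<lless> s \<longrightarrow>
       Limsup F (\<lambda>m. apply_functional m s') \<le> apply_functional l s \<and>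
       apply_functional l s \<le> Liminf F (\<lambda>m. apply_functional m s))"

text \<open>
  A topology is determined by its convergent filters: a set is open iff it belongs to every
  filter converging to one of its points. The lemmas \<open>le_nhds_functional_iff\<close> and
  \<open>tendsto_functional_iff\<close> below show that the topology so defined does have the prescribed
  convergence.
\<close>

instantiation functional :: (ordered_semigroup) topological_space
begin

definition open_functional :: "'a functional set \<Rightarrow> bool"
  where "open_functional U \<longleftrightarrow>
    (\<forall>l\<in>U. \<forall>F. functional_converges F l \<longrightarrow> (\<forall>\<^sub>F m in F. m \<in> U))"

instance
proof
  show "open (UNIV :: 'a functional set)"
    by (simp add: open_functional_def)
  show "open (U \<inter> V)" if "open U" "open V" for U V :: "'a functional set"
    using that by (auto simp: open_functional_def eventually_conj_iff)
  show "open (\<Union>K)" if "\<forall>U\<in>K. open U" for K :: "'a functional set set"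
    unfolding open_functional_def
  proof (intro ballI allI impI)
    fix l F assume "l \<in> \<Union>K" and F: "functional_converges F l"
    then obtain U where U: "U \<in> K" "l \<in> U" by blast
    then have "\<forall>\<^sub>F m in F. m \<in> U"
      using that F by (auto simp: open_functional_def)
    then show "\<forall>\<^sub>F m in F. m \<in> \<Union>K"
      by (rule eventually_mono) (use U in blast)
  qed
qed

end

lemma way_below_le: "(s :: 'a::order) \<lless> t \<Longrightarrow> s \<le> t"
proof -
  assume "s \<lless> t"
  moreover have "has_sup (\<lambda>_::nat. t) t"
    by (simp add: has_sup_def)
  ultimately show ?thesis
    unfolding way_below_def by (metis incseq_const order_refl)
qed

lemma way_below_le_trans: "(r :: 'a::order) \<le> s \<Longrightarrow> s \<lless> t \<Longrightarrow> t \<le> u \<Longrightarrow> r \<lless> u"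
  unfolding way_below_def by (meson order_trans)

lemma way_below_interpolate:
  assumes "(s' :: 'a::cu_semigroup) \<lless> s"
  obtains r where "s' \<lless> r" "r \<lless> s"
proof -
  obtain x where x: "\<And>n. x n \<lless> x (Suc n)" "has_sup x s"
    using O2 by blast
  have "incseq x"
    by (intro incseq_SucI way_below_le x)
  then obtain n where n: "s' \<le> x n"
    using assms x(2) unfolding way_below_def by blast
  have "x (Suc (Suc n)) \<le> s"
    using x(2) by (simp add: has_sup_def)
  then show ?thesis
    using that way_below_le_trans[OF n x(1) order_refl]
      way_below_le_trans[OF order_refl x(1)] by blast
qed

lemma zero_way_below: "(0 :: 'a::ordered_semigroup) \<lless> s"
  by (simp add: way_below_def zero_least)

lemma le_nhds_functional_iff:
  fixes l :: "'a::cu_semigroup functional"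
  shows "F \<le> nhds l \<longleftrightarrow> functional_converges F l"
proof
  assume "functional_converges F l"
  then have "\<forall>\<^sub>F m in F. m \<in> U" if "open U" "l \<in> U" for U
    using that by (simp add: open_functional_def)
  then show "F \<le> nhds l"
    unfolding le_filter_def eventually_nhds by (blast intro: eventually_mono)
next
  assume le: "F \<le> nhds l"
  have ev: "\<forall>\<^sub>F m in F. m \<in> U" if "open U" "l \<in> U" for U
  proof -
    have "eventually (\<lambda>m. m \<in> U) (nhds l)"
      using that by (rule eventually_nhds_in_open)
    then show ?thesis
      using le by (simp add: le_filter_def)
  qed
  have open_gt: "open {m :: 'a functional. a < apply_functional m s}" for a s
    unfolding open_functional_def
  proof (clarsimp)
    fix k :: "'a functional" and G
    assume "functional_converges G k" and "a < apply_functional k s"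
    then have "a < Liminf G (\<lambda>m. apply_functional m s)"
      using zero_way_below[of s] order.strict_trans2 unfolding functional_converges_def by blast
    then show "\<forall>\<^sub>F m in G. a < apply_functional m s"
      by (rule less_LiminfD)
  qed
  have open_lt: "open {m :: 'a functional. \<exists>s. s' \<lless> s \<and> apply_functional m s < a}" for a s'
    unfolding open_functional_def
  proof (clarsimp)
    fix k :: "'a functional" and G s
    assume G: "functional_converges G k" and s: "s' \<lless> s" and less: "apply_functional k s < a"
    obtain r where r: "s' \<lless> r" "r \<lless> s"
      using way_below_interpolate[OF s] .
    have "Limsup G (\<lambda>m. apply_functional m r) < a"
      using G r(2) less order.strict_trans1 unfolding functional_converges_def by blast
    then have "\<forall>\<^sub>F m in G. apply_functional m r < a"
      by (rule Limsup_lessD)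
    then show "\<forall>\<^sub>F m in G. \<exists>s. s' \<lless> s \<and> apply_functional m s < a"
      by (rule eventually_mono) (use r in blast)
  qed
  show "functional_converges F l"
    unfolding functional_converges_def
  proof (intro allI impI conjI)
    fix s' s :: 'a assume s: "s' \<lless> s"
    show "Limsup F (\<lambda>m. apply_functional m s') \<le> apply_functional l s"
      unfolding Limsup_le_iff
    proof (intro allI impI)
      fix a assume "apply_functional l s < a"
      then have "\<forall>\<^sub>F m in F. \<exists>s. s' \<lless> s \<and> apply_functional m s < a"
        using ev[OF open_lt[of s' a]] s by auto
      then show "\<forall>\<^sub>F m in F. apply_functional m s' < a"
      proof (rule eventually_mono)
        fix m :: "'a functional" assume "\<exists>s. s' \<lless> s \<and> apply_functional m s < a"
        moreover have "mono (apply_functional m)"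
          using apply_functional[of m] by (simp add: is_functional_def)
        ultimately show "apply_functional m s' < a"
          by (auto dest!: way_below_le dest: monoD order.strict_trans1)
      qed
    qed
    show "apply_functional l s \<le> Liminf F (\<lambda>m. apply_functional m s)"
      unfolding le_Liminf_iff using ev[OF open_gt] by auto
  qed
qed

lemma tendsto_functional_iff:
  fixes l :: "'a::cu_semigroup functional"
  shows "(x \<longlongrightarrow> l) N \<longleftrightarrow>
    (\<forall>s' s. s' \<lless> s \<longrightarrow>
       Limsup N (\<lambda>i. apply_functional (x i) s') \<le> apply_functional l s \<and>
       apply_functional l s \<le> Liminf N (\<lambda>i. apply_functional (x i) s))"
  unfolding filterlim_def le_nhds_functional_iff functional_converges_def
    Limsup_le_iff le_Liminf_iff eventually_filtermap ..


definition lower_semicontinuous :: "('b::topological_space \<Rightarrow> ennreal) \<Rightarrow> bool"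
  where "lower_semicontinuous f \<longleftrightarrow> (\<forall>a. open {x. a < f x})"

definition Lsc :: "('a::ordered_semigroup functional \<Rightarrow> ennreal) set"
  where "Lsc = {f. lower_semicontinuous f \<and>
    (\<forall>l m. f (l + m) = f l + f m) \<and>
    (\<forall>c>0. \<forall>l. f (scale_functional c l) = ennreal c * f l) \<and>
    f 0 = 0}"

definition hat :: "'a::ordered_semigroup \<Rightarrow> 'a functional \<Rightarrow> ennreal"
  where "hat s = (\<lambda>l. apply_functional l s)"

definition S_R :: "('a::ordered_semigroup functional \<Rightarrow> ennreal) set"
  where "S_R = {f \<in> Lsc. \<exists>(s :: nat \<Rightarrow> 'a) (n :: nat \<Rightarrow> nat).
    (\<forall>i. 0 < n i) \<and>
    incseq (\<lambda>i l. hat (s i) l / of_nat (n i)) \<and>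
    (\<forall>l. f l = (SUP i. hat (s i) l / of_nat (n i)))}"

text \<open>
  The factor \<open>1 - \<epsilon>\<close> is a positive scalar, hence \<open>\<epsilon> < 1\<close>.
  Continuity is with respect to the order topology on \<^typ>\<open>ennreal\<close>.
\<close>

definition strongly_below ::
    "('a::ordered_semigroup functional \<Rightarrow> ennreal) \<Rightarrow> ('a functional \<Rightarrow> ennreal) \<Rightarrow> bool"
    (infix \<open>\<lhd>\<close> 50)
  where "f \<lhd> g \<longleftrightarrow>
    (\<exists>\<epsilon>::real. 0 < \<epsilon> \<and> \<epsilon> < 1 \<and> (\<forall>l. f l \<le> ennreal (1 - \<epsilon>) * g l)) \<and>
    (\<forall>l. g l < \<infinity> \<longrightarrow> (f \<longlongrightarrow> f l) (nhds l))"

definition L_F :: "('a::ordered_semigroup functional \<Rightarrow> ennreal) set"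
  where "L_F = {f \<in> Lsc. \<exists>g :: nat \<Rightarrow> 'a functional \<Rightarrow> ennreal.
    (\<forall>n. g n \<in> Lsc) \<and> incseq g \<and> (\<forall>n. g n \<lhd> g (Suc n)) \<and>
    (\<forall>l. f l = (SUP n. g n l))}"

end

theory Submission
  imports Defs
begin

text \<open>
  The cone F(S) is compact: a pointwise limit of functionals is additive and monotone, and
  taking suprema over way-below elements turns it into a functional. By O5 the pointwise order on
  F(S) is algebraic, so functions in Lsc(F(S)) are monotone.

  For the inclusion of L(F(S)) in \<open>S\<^sub>\<real>\<close> it suffices to insert some \<open>s/n\<close> between \<open>f \<lhd> g\<close>. If
  \<open>g m < g l\<close>, then \<open>l\<close> is not below \<open>m\<close>, so some \<open>s\<close> separates the two functionals. Compactness of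
  \<open>{g \<le> \<theta>}\<close> and of the closure of \<open>{f > 1}\<close> reduces the problem to finitely many separating
  elements, and these are merged by two applications of a minimax argument (first over the \<open>m\<close>, then
  over the \<open>l\<close>), giving a real combination of elements that is finally made rational.

  For the converse, a dyadic chain of elements between \<open>a \<lless> b\<close> has lower Riemann sums which increase
  to a function between \<open>a\<close> and \<open>b\<close> that is continuous wherever something way above \<open>b\<close> is finite.
  Hence every \<open>s/n\<close> lies in L(F(S)), and L(F(S)) is closed under increasing suprema because, by
  compactness, \<open>f \<lhd> sup g\<^sub>n\<close> implies \<open>f \<le> g\<^sub>n\<close> for large \<open>n\<close>.
\<close>

section \<open>Regularization, compactness and complements\<close>

lemma rapid_sequence:
  fixes s :: "'a::cu_semigroup"
  shows "\<exists>x. incseq x \<and> (\<forall>n. x n \<lless> x (Suc n)) \<and> has_sup x s \<and> (\<forall>n. x n \<lless> s)"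
proof -
  obtain x where x: "\<And>n. x n \<lless> x (Suc n)" "has_sup x s"
    using O2 by blast
  have "x n \<lless> s" for n
    using way_below_le_trans[OF order_refl x(1)] x(2) unfolding has_sup_def by blast
  moreover have "incseq x"
    by (intro incseq_SucI way_below_le x)
  ultimately show ?thesis
    using x by blast
qed

text \<open>The part of being a functional that survives pointwise limits and pointwise differences;
  preservation of suprema is restored afterwards by regularization.\<close>

definition additive_mono :: "('a::ordered_semigroup \<Rightarrow> ennreal) \<Rightarrow> bool"
  where "additive_mono m \<longleftrightarrow> (\<forall>s t. m (s + t) = m s + m t) \<and> mono m \<and> m 0 = 0"

lemma functional_additive_mono: "additive_mono (apply_functional l)"
  using apply_functional[of l] by (simp add: additive_mono_def is_functional_def)

lemma apply_add: "apply_functional l (s + t) = apply_functional l s + apply_functional l t"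
  using functional_additive_mono[of l] by (simp add: additive_mono_def)

lemma apply_mono: "s \<le> t \<Longrightarrow> apply_functional l s \<le> apply_functional l t"
  using functional_additive_mono[of l] by (simp add: additive_mono_def mono_def)

lemma apply_zero: "apply_functional l 0 = 0"
  using functional_additive_mono[of l] by (simp add: additive_mono_def)

lemma apply_has_sup: "incseq x \<Longrightarrow> has_sup x s \<Longrightarrow> apply_functional l s = (SUP n. apply_functional l (x n))"
  using apply_functional[of l] by (simp add: is_functional_def)

text \<open>On a \<open>cu_semigroup\<close>, for additive monotone \<open>m\<close>, this is the
  largest functional below \<open>m\<close>.\<close>

definition regularization :: "('a::order \<Rightarrow> ennreal) \<Rightarrow> 'a \<Rightarrow> ennreal"
  where "regularization m s = (SUP s'\<in>{s'. s' \<lless> s}. m s')"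

text \<open>A sequence increasing rapidly to \<open>s\<close> is cofinal among the elements way
  below \<open>s\<close>. Computing along such a sequence makes O3 and O4 applicable.\<close>

lemma regularization_eq_SUP:
  assumes "mono m" and x: "incseq x" "\<And>n. x n \<lless> x (Suc n)" "has_sup x s"
  shows "regularization m s = (SUP n. m (x n))"
  unfolding regularization_def
proof (intro antisym SUP_least)
  fix s' assume "s' \<in> {s'. s' \<lless> s}"
  then obtain n where "s' \<le> x n"
    using x unfolding way_below_def by blast
  then show "m s' \<le> (SUP n. m (x n))"
    using \<open>mono m\<close> by (meson SUP_upper2 UNIV_I monoD)
next
  fix n
  have "x n \<lless> s"
    using way_below_le_trans[OF order_refl x(2)] x(3) unfolding has_sup_def by blast
  then show "m (x n) \<le> (SUP s'\<in>{s'. s' \<lless> s}. m s')"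
    by (intro SUP_upper) simp
qed

lemma regularization_le: "mono m \<Longrightarrow> regularization m s \<le> m s"
  unfolding regularization_def by (intro SUP_least) (auto dest: way_below_le monoD)

lemma le_regularization: "s' \<lless> s \<Longrightarrow> m s' \<le> regularization m s"
  unfolding regularization_def by (intro SUP_upper) simp

text \<open>Additivity: the sum of rapid sequences for \<open>s\<close> and \<open>t\<close> is, by
  O3 and O4, a rapid sequence for \<open>s + t\<close>. Suprema: if \<open>s' \<lless> u\<close>, an
  interpolated element already lies below some \<open>t n\<close> and is still way above
  \<open>s'\<close>.\<close>

lemma is_functional_regularization:
  fixes m :: "'a::cu_semigroup \<Rightarrow> ennreal"
  assumes "additive_mono m"
  shows "is_functional (regularization m)"
proof -
  have m: "m (s + t) = m s + m t" "mono m" "m 0 = 0" for s t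
    using assms by (auto simp: additive_mono_def)
  have reg_mono: "regularization m s \<le> regularization m t" if "s \<le> t" for s t
    unfolding regularization_def using that
    by (intro SUP_subset_mono) (auto intro: way_below_le_trans)
  have "regularization m (s + t) = regularization m s + regularization m t" for s t
  proof -
    obtain x where x: "incseq x" "\<And>n. x n \<lless> x (Suc n)" "has_sup x s" "\<And>n. x n \<lless> s"
      using rapid_sequence[of s] by auto
    obtain y where y: "incseq y" "\<And>n. y n \<lless> y (Suc n)" "has_sup y t" "\<And>n. y n \<lless> t"
      using rapid_sequence[of t] by auto
    have "incseq (\<lambda>n. x n + y n)"
      using x(1) y(1) by (simp add: incseq_def add_mono)
    then have "regularization m (s + t) = (SUP n. m (x n + y n))"
      using x y by (intro regularization_eq_SUP m O3 O4) auto
    also have "\<dots> = (SUP n. m (x n) + m (y n))"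
      by (simp add: m)
    also have "\<dots> = (SUP n. m (x n)) + (SUP n. m (y n))"
      using x(1) y(1) m(2) by (intro ennreal_SUP_add) (auto simp: incseq_def mono_def)
    finally show ?thesis
      using regularization_eq_SUP[OF m(2) x(1-3)] regularization_eq_SUP[OF m(2) y(1-3)] by simp
  qed
  moreover have "regularization m u = (SUP n. regularization m (t n))"
    if t: "incseq t" "has_sup t u" for t u
  proof (rule antisym)
    show "regularization m u \<le> (SUP n. regularization m (t n))"
      unfolding regularization_def[of m u]
    proof (rule SUP_least)
      fix s' assume "s' \<in> {s'. s' \<lless> u}"
      then obtain r where r: "s' \<lless> r" "r \<lless> u"
        using way_below_interpolate by blast
      then obtain n where "r \<le> t n"
        using t unfolding way_below_def by blast
      then have "m s' \<le> regularization m (t n)"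
        using r(1) by (intro le_regularization) (auto intro: way_below_le_trans)
      then show "m s' \<le> (SUP n. regularization m (t n))"
        by (meson SUP_upper2 UNIV_I)
    qed
    show "(SUP n. regularization m (t n)) \<le> regularization m u"
      using t(2) by (intro SUP_least reg_mono) (simp add: has_sup_def)
  qed
  moreover have "regularization m 0 = 0"
    using regularization_le[OF m(2), of 0] m(3) by simp
  ultimately show ?thesis
    using reg_mono by (auto simp: is_functional_def mono_def)
qed

text \<open>The product of copies of \<open>ennreal\<close> is compact, so the filter has a
  pointwise cluster point \<open>m\<close>. It may fail to preserve suprema, but convergence in F(S)
  compares values at \<open>s' \<lless> s\<close> only and so tolerates replacing \<open>m\<close>
  by its regularization.\<close>

lemma compact_functional: "compact (UNIV :: 'a::cu_semigroup functional set)"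
  unfolding compact_filter
proof (intro allI impI)
  fix F :: "'a functional filter"
  assume "F \<noteq> bot"
  have "compact (UNIV :: ('a \<Rightarrow> ennreal) set)"
  proof -
    have "compact_space (product_topology (\<lambda>_::'a. euclidean :: ennreal topology) UNIV)"
      using compact_UNIV[where ?'a=ennreal] by (simp only: compact_space_product_topology) (simp add: compact_space_def)
    then show ?thesis
      by (simp add: compact_space_def euclidean_product_topology)
  qed
  then obtain m where m: "inf (nhds m) (filtermap apply_functional F) \<noteq> bot"
    using \<open>F \<noteq> bot\<close> unfolding compact_filter
    by (elim allE[of _ "filtermap apply_functional F"]) (auto simp: filtermap_bot_iff)
  \<comment> \<open>A refinement of \<open>F\<close> along which all evaluations converge to the
    values of \<open>m\<close>; it is proper because \<open>m\<close> is a cluster point.\<close>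
  define G where "G = inf F (filtercomap apply_functional (nhds m))"
  have "G \<noteq> bot"
  proof
    assume "G = bot"
    then have "eventually (\<lambda>_. False) (inf F (filtercomap apply_functional (nhds m)))"
      by (simp add: G_def)
    then obtain P Q where PQ: "eventually P F"
      "eventually Q (filtercomap apply_functional (nhds m))" "\<And>l. P l \<Longrightarrow> Q l \<Longrightarrow> False"
      unfolding eventually_inf by blast
    then obtain R where R: "eventually R (nhds m)" "\<And>l. R (apply_functional l) \<Longrightarrow> Q l"
      unfolding eventually_filtercomap by blast
    have "eventually (\<lambda>k. \<exists>l. P l \<and> k = apply_functional l) (filtermap apply_functional F)"
      using PQ(1) by (auto simp: eventually_filtermap elim: eventually_mono)
    then have "eventually (\<lambda>_. False) (inf (nhds m) (filtermap apply_functional F))"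
      unfolding eventually_inf using R PQ(3) by (intro exI[of _ R] exI) auto
    then show False
      using m by (simp add: trivial_limit_def)
  qed
  have "filterlim apply_functional (nhds m) G"
    unfolding G_def by (simp add: filterlim_iff_le_filtercomap)
  then have G_lim: "(apply_functional \<longlongrightarrow> m) G" .
  have lim: "((\<lambda>l. apply_functional l s) \<longlongrightarrow> m s) G" for s
  proof (rule topological_tendstoI)
    fix U :: "ennreal set" assume U: "open U" "m s \<in> U"
    have "open ((\<lambda>k. k s) -` U)"
      using U(1) by (intro open_vimage continuous_on_product_coordinates)
    then have "eventually (\<lambda>l. apply_functional l \<in> (\<lambda>k. k s) -` U) G"
      using U(2) by (intro topological_tendstoD[OF G_lim]) auto
    then show "eventually (\<lambda>l. apply_functional l s \<in> U) G"
      by simp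
  qed
  have "additive_mono m"
    unfolding additive_mono_def
  proof (intro conjI allI monoI)
    fix s t :: 'a
    have "((\<lambda>l. apply_functional l (s + t)) \<longlongrightarrow> m s + m t) G"
      unfolding apply_add by (intro tendsto_add lim)
    then show "m (s + t) = m s + m t"
      using lim tendsto_unique \<open>G \<noteq> bot\<close> by blast
    show "m s \<le> m t" if "s \<le> t"
      using \<open>G \<noteq> bot\<close> lim lim by (rule tendsto_le) (simp add: apply_mono that)
    show "m 0 = 0"
      using lim[of 0] \<open>G \<noteq> bot\<close> by (simp add: apply_zero tendsto_const_iff)
  qed
  \<comment> \<open>The limit in F(S): \<open>s' \<lless> s\<close> gives
    \<open>m s' \<le> regularization m s \<le> m s\<close>, exactly the two bounds that convergence
    demands.\<close>
  define l where "l = Functional (regularization m)"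
  have l: "apply_functional l = regularization m"
    unfolding l_def using is_functional_regularization[OF \<open>additive_mono m\<close>]
    by (simp add: Functional_inverse)
  have "functional_converges G l"
    unfolding functional_converges_def l
    using lim_imp_Limsup[OF \<open>G \<noteq> bot\<close> lim] lim_imp_Liminf[OF \<open>G \<noteq> bot\<close> lim] \<open>additive_mono m\<close>
    by (auto simp: le_regularization additive_mono_def intro: regularization_le)
  then have "G \<le> inf (nhds l) F"
    by (simp add: le_nhds_functional_iff G_def)
  then show "\<exists>l\<in>UNIV. inf (nhds l) F \<noteq> bot"
    using \<open>G \<noteq> bot\<close> by (metis UNIV_I bot.extremum_uniqueI)
qed

text \<open>
  The complement is the regularization of the pointwise difference, which is monotone by O5.
\<close>

lemma functional_le_imp_ex_add:
  fixes l k :: "'a::cu_semigroup functional"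
  assumes le: "\<And>s. apply_functional l s \<le> apply_functional k s"
  shows "\<exists>j. k = l + j"
proof -
  let ?l = "apply_functional l" and ?k = "apply_functional k"
  \<comment> \<open>In \<^typ>\<open>ennreal\<close>, \<open>top - top = top\<close>, which is the value wanted here.\<close>
  define m where "m s = ?k s - ?l s" for s
  have m: "?l s + m s = ?k s" for s
    unfolding m_def using le by (simp add: add_diff_inverse_ennreal)
  have "additive_mono m"
    unfolding additive_mono_def
  proof (intro conjI allI monoI)
    fix s t :: 'a
    have "?l (s + t) + (m s + m t) = ?k (s + t)"
      using m[of s] m[of t] by (simp add: apply_add) (metis add.assoc add.left_commute)
    show "m (s + t) = m s + m t"
    proof (cases "?l (s + t) = top")
      case True
      then have "m s + m t = top"
        using le[of s] le[of t] by (auto simp: m_def apply_add ennreal_add_eq_top top_unique)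
      then show ?thesis
        using True le[of "s + t"] by (auto simp: m_def[of "s + t"] top_unique)
    next
      case False
      have "?l (s + t) + m (s + t) = ?l (s + t) + (m s + m t)"
        by (simp only: m \<open>?l (s + t) + (m s + m t) = ?k (s + t)\<close>)
      then show ?thesis
        using False by (simp add: ennreal_add_left_cancel)
    qed
    show "m 0 = 0"
      by (simp add: m_def apply_zero)
    assume "s \<le> t"
    \<comment> \<open>Monotonicity of the difference, written without subtraction because values may
      be infinite. O5 gives it with \<open>s'\<close> in place of \<open>s\<close>, and the supremum
      over a rapid sequence then gives it for \<open>s\<close>.\<close>
    have *: "?k s' + ?l t \<le> ?l s + ?k t" if s': "s' \<lless> s" for s'
    proof -
      obtain r where r: "s' + r \<le> t" "t \<le> s + r"
        using O5[OF s' \<open>s \<le> t\<close>] by blast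
      have "?k s' + ?l t \<le> ?k s' + (?l s + ?l r)"
        using apply_mono[OF r(2), of l] by (simp add: apply_add add_left_mono)
      also have "\<dots> \<le> ?l s + (?k s' + ?k r)"
        using le[of r] by (simp add: ac_simps add_left_mono)
      also have "\<dots> \<le> ?l s + ?k t"
        using apply_mono[OF r(1), of k] by (simp add: apply_add add_left_mono)
      finally show ?thesis .
    qed
    obtain x where x: "incseq x" "\<And>n. x n \<lless> x (Suc n)" "has_sup x s" "\<And>n. x n \<lless> s"
      using rapid_sequence[of s] by auto
    have "?k s + ?l t = (SUP n. ?k (x n) + ?l t)"
      using apply_has_sup[OF x(1,3), of k] by (simp add: ennreal_SUP_add_left)
    also have "\<dots> \<le> ?l s + ?k t"
      using x(4) by (intro SUP_least *)
    finally have "?k s + ?l t \<le> ?l s + ?k t" .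
    show "m s \<le> m t"
    proof (cases "?l t = top")
      case True
      then show ?thesis
        using le[of t] by (simp add: m_def top_unique)
    next
      case False
      have "?l t + ?k s \<le> ?l t + (?l s + m t)"
        using \<open>?k s + ?l t \<le> ?l s + ?k t\<close> m[of t] by (metis add.commute add.left_commute)
      then have "?k s \<le> ?l s + m t"
        using False by (simp add: ennreal_add_left_cancel_le)
      moreover have "?l s \<noteq> top"
        using False apply_mono[OF \<open>s \<le> t\<close>, of l] by (auto simp: top_unique)
      ultimately show ?thesis
        unfolding m_def[of s] by (simp add: ennreal_minus_le_iff)
    qed
  qed
  define j where "j = Functional (regularization m)"
  have j: "apply_functional j = regularization m"
    unfolding j_def using is_functional_regularization[OF \<open>additive_mono m\<close>]
    by (simp add: Functional_inverse)
  have "mono m"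
    using \<open>additive_mono m\<close> by (simp add: additive_mono_def)
  \<comment> \<open>Both \<open>?k\<close> and \<open>?l\<close> preserve suprema, so taking the
    supremum of \<open>?l + m = ?k\<close> along a rapid sequence turns \<open>m\<close> into its
    regularization.\<close>
  have "?k s = ?l s + regularization m s" for s
  proof -
    obtain x where x: "incseq x" "\<And>n. x n \<lless> x (Suc n)" "has_sup x s" "\<And>n. x n \<lless> s"
      using rapid_sequence[of s] by auto
    have "?k s = (SUP n. ?l (x n) + m (x n))"
      using apply_has_sup[OF x(1,3), of k] by (simp add: m)
    also have "\<dots> = (SUP n. ?l (x n)) + (SUP n. m (x n))"
      using x(1) \<open>mono m\<close> by (intro ennreal_SUP_add) (auto simp: incseq_def mono_def apply_mono)
    finally show ?thesis
      using regularization_eq_SUP[OF \<open>mono m\<close> x(1-3)] apply_has_sup[OF x(1,3), of l] by simp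
  qed
  then have "apply_functional k = apply_functional (l + j)"
    by (simp add: plus_functional.rep_eq j fun_eq_iff)
  then show ?thesis
    using apply_functional_inject by blast
qed

section \<open>Lower semicontinuous linear functions\<close>

lemma LscD:
  assumes "f \<in> Lsc"
  shows Lsc_lower_semicontinuous: "lower_semicontinuous f"
    and Lsc_add: "f (l + m) = f l + f m"
    and Lsc_scale: "0 < c \<Longrightarrow> f (scale_functional c l) = ennreal c * f l"
    and Lsc_zero: "f 0 = 0"
  using assms by (auto simp: Lsc_def)

text \<open>The pointwise inequality makes \<open>m\<close> a sum of \<open>l\<close> and another
  functional, and \<open>f\<close> is additive with nonnegative values.\<close>

lemma Lsc_mono:
  fixes f :: "'a::cu_semigroup functional \<Rightarrow> ennreal"
  assumes "f \<in> Lsc" and "\<And>s. apply_functional l s \<le> apply_functional m s"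
  shows "f l \<le> f m"
proof -
  obtain j where "m = l + j"
    using functional_le_imp_ex_add[OF assms(2)] by blast
  then show ?thesis
    by (simp add: Lsc_add[OF assms(1)])
qed

lemma open_apply_greater: "open {m :: 'a::cu_semigroup functional. a < apply_functional m s}"
  unfolding open_functional_def
proof (clarsimp)
  fix k :: "'a functional" and F
  assume "functional_converges F k" and "a < apply_functional k s"
  then have "a < Liminf F (\<lambda>m. apply_functional m s)"
    using zero_way_below[of s] order.strict_trans2 unfolding functional_converges_def by blast
  then show "\<forall>\<^sub>F m in F. a < apply_functional m s"
    by (rule less_LiminfD)
qed

text \<open>Evaluation at one element is lower semicontinuous but need not be continuous; an upper
  bound near \<open>l\<close> is available only after descending from \<open>s\<close> to some
  \<open>s'\<close> way below it.\<close>

lemma eventually_apply_less: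
  fixes l :: "'a::cu_semigroup functional"
  assumes "s' \<lless> s" and "apply_functional l s < a"
  shows "\<forall>\<^sub>F m in nhds l. apply_functional m s' < a"
proof -
  have "functional_converges (nhds l) l"
    by (simp flip: le_nhds_functional_iff)
  then have "Limsup (nhds l) (\<lambda>m. apply_functional m s') < a"
    using assms order.strict_trans1 unfolding functional_converges_def by blast
  then show ?thesis
    by (rule Limsup_lessD)
qed

section \<open>Closure of \<open>Lsc\<close> under sums, multiples and increasing suprema\<close>

lemma ennreal_less_add_split:
  fixes u v :: ennreal
  assumes "a < u + v" "u \<noteq> 0" "v \<noteq> 0"
  obtains p q where "p < u" "q < v" "a < p + q"
proof -
  have "0 \<in> {..<u}" "0 \<in> {..<v}"
    using assms(2,3) by (auto simp: zero_less_iff_neq_zero)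
  then have "{..<u} \<noteq> {}" "{..<v} \<noteq> {}" "Sup {..<u} = u" "Sup {..<v} = v"
    using Sup_lessThan by blast+
  then have "u + v = (SUP p\<in>{..<u}. p + v)"
    by (simp add: ennreal_SUP_add_left)
  then obtain p where p: "p < u" "a < p + v"
    using assms(1) by (auto simp: less_SUP_iff)
  have "p + v = (SUP q\<in>{..<v}. p + q)"
    using ennreal_SUP_add_right[OF \<open>{..<v} \<noteq> {}\<close>, of p "\<lambda>q. q"] \<open>Sup {..<v} = v\<close> by simp
  then obtain q where "q < v" "a < p + q"
    using p by (auto simp: less_SUP_iff)
  then show ?thesis
    using p that by blast
qed

lemma lower_semicontinuous_add:
  assumes f: "lower_semicontinuous f" and g: "lower_semicontinuous g"
  shows "lower_semicontinuous (\<lambda>x. f x + g x)"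
  unfolding lower_semicontinuous_def
proof (intro allI, subst open_subopen, intro ballI)
  fix a x assume "x \<in> {x. a < f x + g x}"
  then have a: "a < f x + g x"
    by simp
  have open_f: "open {y. p < f y}" and open_g: "open {y. p < g y}" for p
    using f g by (auto simp: lower_semicontinuous_def)
  \<comment> \<open>Nothing lies strictly below 0, so a vanishing summand cannot be split off; in
    that case the other summand alone exceeds \<open>a\<close>.\<close>
  consider "f x = 0" | "g x = 0" | "f x \<noteq> 0" "g x \<noteq> 0"
    by blast
  then show "\<exists>T. open T \<and> x \<in> T \<and> T \<subseteq> {x. a < f x + g x}"
  proof cases
    case 1
    then show ?thesis
      using a open_g[of a] by (intro exI[of _ "{y. a < g y}"]) (auto intro: order.strict_trans2)
  next
    case 2
    then show ?thesis
      using a open_f[of a] by (intro exI[of _ "{y. a < f y}"]) (auto intro: order.strict_trans2)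
  next
    case 3
    then obtain p q where "p < f x" "q < g x" "a < p + q"
      using a ennreal_less_add_split by blast
    then show ?thesis
      using open_f[of p] open_g[of q]
      by (intro exI[of _ "{y. p < f y} \<inter> {y. q < g y}"])
        (auto intro: order.strict_trans1 less_imp_le add_mono order.strict_trans2)
  qed
qed

lemma lower_semicontinuous_cmult:
  assumes "lower_semicontinuous f" and "0 < c"
  shows "lower_semicontinuous (\<lambda>x. ennreal c * f x)"
proof -
  have "{x. a < ennreal c * f x} = {x. a / ennreal c < f x}" for a
    using assms(2) by (auto simp: divide_less_ennreal mult.commute ennreal_zero_less_divide)
  then show ?thesis
    using assms(1) by (simp add: lower_semicontinuous_def)
qed

lemma lower_semicontinuous_SUP:
  assumes "\<And>i. lower_semicontinuous (f i)"
  shows "lower_semicontinuous (\<lambda>x. SUP i. f i x)"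
proof -
  have "{x. a < (SUP i. f i x)} = (\<Union>i. {x. a < f i x})" for a
    by (auto simp: less_SUP_iff)
  then show ?thesis
    using assms by (auto simp: lower_semicontinuous_def)
qed

lemma hat_in_Lsc: "hat (s :: 'a::cu_semigroup) \<in> Lsc"
  by (simp add: Lsc_def hat_def lower_semicontinuous_def open_apply_greater
      plus_functional.rep_eq scale_functional.rep_eq zero_functional.rep_eq)

lemma Lsc_plus: "f \<in> Lsc \<Longrightarrow> g \<in> Lsc \<Longrightarrow> (\<lambda>x. f x + g x) \<in> Lsc"
  by (simp add: Lsc_def lower_semicontinuous_add distrib_left ac_simps)

lemma Lsc_cmult:
  assumes "f \<in> Lsc" and "0 \<le> c"
  shows "(\<lambda>x. ennreal c * f x) \<in> Lsc"
proof (cases "c = 0")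
  case True
  then show ?thesis
    by (simp add: Lsc_def lower_semicontinuous_def)
next
  case False
  then show ?thesis
    using assms by (simp add: Lsc_def lower_semicontinuous_cmult distrib_left mult.left_commute)
qed

lemma Lsc_SUP:
  assumes f: "\<And>i. f i \<in> Lsc" and "incseq f"
  shows "(\<lambda>x. SUP i::nat. f i x) \<in> Lsc"
proof -
  have inc: "incseq (\<lambda>i. f i x)" for x
    using assms(2) by (auto simp: incseq_def le_fun_def)
  show ?thesis
    unfolding Lsc_def using f inc
    by (auto simp: LscD lower_semicontinuous_SUP ennreal_SUP_add SUP_mult_left_ennreal)
qed

text \<open>Homogeneity: if \<open>g x < q * f x\<close>, dividing \<open>x\<close> by a number
  strictly between \<open>g x / q\<close> and \<open>f x\<close> yields a point where
  \<open>f\<close> exceeds 1 and \<open>g\<close> is less than \<open>q\<close>. Inequalities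
  between linear functions thus need checking on one superlevel set only.\<close>

lemma Lsc_le_if_superlevel_le:
  assumes f: "f \<in> Lsc" and g: "g \<in> Lsc" and "0 < q"
    and le: "\<And>x. 1 < f x \<Longrightarrow> ennreal q \<le> g x"
  shows "ennreal q * f x \<le> g x"
proof (rule ccontr)
  assume "\<not> ennreal q * f x \<le> g x"
  then have "g x / ennreal q < f x"
    using \<open>0 < q\<close> by (simp add: not_le divide_less_ennreal mult.commute)
  then obtain r where r: "g x / ennreal q < r" "r < f x"
    using dense by blast
  have "g x < r * ennreal q"
    using r(1) \<open>0 < q\<close> by (simp add: divide_less_ennreal)
  have "0 < r"
    using zero_le r(1) by (rule le_less_trans)
  moreover have "r < top"
    using r(2) top_greatest by (rule less_le_trans)
  ultimately obtain c where c: "r = ennreal c" "0 < c"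
    by (cases r) auto
  let ?y = "scale_functional (1 / c) x"
  have "1 = ennreal (1 / c) * ennreal c"
    using c by (simp flip: ennreal_mult)
  also have "\<dots> < ennreal (1 / c) * f x"
    using r c by (intro ennreal_mult_strict_left_mono) auto
  finally have "ennreal q \<le> g ?y"
    using c by (intro le) (simp add: Lsc_scale[OF f])
  then have "ennreal c * ennreal q \<le> ennreal c * (ennreal (1 / c) * g x)"
    using c by (intro mult_left_mono) (auto simp: Lsc_scale[OF g])
  also have "\<dots> = g x"
    using c by (simp flip: ennreal_mult mult.assoc)
  finally show False
    using \<open>g x < r * ennreal q\<close> c by simp
qed

text \<open>Where \<open>g l \<le> \<theta> < 1 / (1 - \<epsilon>)\<close>, the value
  \<open>g l\<close> is finite and \<open>f l < 1\<close>. Continuity of \<open>f\<close> at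
  \<open>l\<close> then keeps \<open>f\<close> below 1 on a neighbourhood, so \<open>l\<close> is
  not in the closure.\<close>

lemma closure_superlevel_strongly_below:
  assumes fg: "f \<lhd> g"
  shows "\<exists>\<theta>>1. closure {x. 1 < f x} \<subseteq> {x. ennreal \<theta> < g x}"
proof -
  obtain \<epsilon> where \<epsilon>: "0 < \<epsilon>" "\<epsilon> < 1" "\<And>l. f l \<le> ennreal (1 - \<epsilon>) * g l"
    and cont: "\<And>l. g l < \<infinity> \<Longrightarrow> (f \<longlongrightarrow> f l) (nhds l)"
    using fg unfolding strongly_below_def by blast
  obtain \<theta> where \<theta>: "1 < \<theta>" "\<theta> < 1 / (1 - \<epsilon>)"
    using \<epsilon> dense[of 1 "1 / (1 - \<epsilon>)"] by (auto simp: field_simps)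
  have "ennreal \<theta> < g l" if l: "l \<in> closure {x. 1 < f x}" for l
  proof (rule ccontr)
    assume "\<not> ennreal \<theta> < g l"
    then have g: "g l \<le> ennreal \<theta>"
      by simp
    have "f l \<le> ennreal (1 - \<epsilon>) * ennreal \<theta>"
      using \<epsilon>(3)[of l] g by (meson mult_left_mono order_trans zero_le)
    also have "\<dots> = ennreal ((1 - \<epsilon>) * \<theta>)"
      using \<epsilon> \<theta> by (simp add: ennreal_mult)
    also have "\<dots> < 1"
      using \<epsilon> \<theta> by (simp add: ennreal_less_one_iff field_simps)
    finally have "f l < 1" .
    moreover have "g l < \<infinity>"
      using g by (simp add: le_less_trans)
    ultimately have "eventually (\<lambda>x. f x < 1) (nhds l)"
      using order_tendstoD(2)[OF cont] by blast
    then obtain U where U: "open U" "l \<in> U" "\<And>x. x \<in> U \<Longrightarrow> f x < 1"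
      unfolding eventually_nhds by blast
    then have "U \<inter> {x. 1 < f x} = {}"
      by (auto dest: less_asym)
    then show False
      using U l open_Int_closure_eq_empty[OF U(1)] by blast
  qed
  then show ?thesis
    using \<theta>(1) by blast
qed

text \<open>The closure of \<open>{f > 1}\<close> is compact and covered by the increasing open sets
  \<open>{g n > 1}\<close>, so one of them contains it; homogeneity turns this into an inequality
  everywhere.\<close>

lemma strongly_below_SUP:
  fixes f :: "'a::cu_semigroup functional \<Rightarrow> ennreal"
  assumes f: "f \<in> Lsc" and g: "\<And>n. g n \<in> Lsc" "incseq g" and fg: "f \<lhd> (\<lambda>l. SUP n. g n l)"
  shows "\<forall>\<^sub>F n in sequentially. \<forall>l. f l \<le> g n l"
proof -
  let ?A = "closure {x. 1 < f x}"
  obtain \<theta> :: real where \<theta>: "1 < \<theta>" "?A \<subseteq> {x. ennreal \<theta> < (SUP n. g n x)}"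
    using closure_superlevel_strongly_below[OF fg] by auto
  have "1 < ennreal \<theta>"
    using \<theta>(1) by simp
  have "compact ?A"
    using compact_Int_closed[OF compact_functional, of ?A] by simp
  moreover have "open {x. 1 < g n x}" for n
    using Lsc_lower_semicontinuous[OF g(1)] by (simp add: lower_semicontinuous_def)
  moreover have "?A \<subseteq> (\<Union>n. {x. 1 < g n x})"
  proof
    fix x assume "x \<in> ?A"
    from subsetD[OF \<theta>(2) this] have "1 < (SUP n. g n x)"
      using less_trans[OF \<open>1 < ennreal \<theta>\<close>] by simp
    then show "x \<in> (\<Union>n. {x. 1 < g n x})"
      by (auto simp: less_SUP_iff)
  qed
  ultimately have "\<exists>N. finite N \<and> ?A \<subseteq> (\<Union>n\<in>N. {x. 1 < g n x})"
    by (rule compactE_image[of ?A UNIV "\<lambda>n. {x. 1 < g n x}"]) blast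
  then obtain N where N: "finite N" "?A \<subseteq> (\<Union>n\<in>N. {x. 1 < g n x})"
    by auto
  \<comment> \<open>If \<open>N\<close> is empty then so is \<open>?A\<close>, and the unspecified
    value of \<open>Max N\<close> does no harm.\<close>
  have "f l \<le> g n l" if "Max N \<le> n" for n l
  proof -
    have "ennreal 1 * f l \<le> g n l"
    proof (rule Lsc_le_if_superlevel_le[OF f g(1)])
      fix x assume "1 < f x"
      then have "x \<in> ?A"
        by (intro subsetD[OF closure_subset]) simp
      then obtain k where k: "k \<in> N" "1 < g k x"
        using N(2) by blast
      then have "g k \<le> g n"
        using that N(1) g(2) by (meson Max_ge incseqD order_trans)
      then have "1 < g n x"
        using less_le_trans[OF k(2)] by (simp add: le_fun_def)
      then show "ennreal 1 \<le> g n x"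
        by simp
    qed simp
    then show ?thesis
      by simp
  qed
  then show ?thesis
    unfolding eventually_sequentially by blast
qed

section \<open>A minimax principle for linear functions\<close>

text \<open>\<open>P\<close> misses the open quadrant below \<open>(q, q)\<close>. A separating
  hyperplane has nonnegative coefficients, since the quadrant is unbounded downwards, and dividing
  by their sum gives the weights.\<close>

lemma separate_from_quadrant:
  fixes P :: "(real \<times> real) set"
  assumes "convex P" and P: "\<And>x y. (x, y) \<in> P \<Longrightarrow> q \<le> x \<or> q \<le> y"
  shows "\<exists>c. 0 \<le> c \<and> c \<le> 1 \<and> (\<forall>(x, y)\<in>P. q \<le> c * x + (1 - c) * y)"
proof (cases "P = {}")
  case True
  then show ?thesis
    by (intro exI[of _ 0]) simp
next
  case False
  let ?Q = "{..<q} \<times> {..<q}"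
  have "convex ?Q"
    by (intro convex_Times convex_real_interval)
  moreover have "?Q \<noteq> {}"
    by (auto simp: lessThan_def intro: exI[of _ "q - 1"])
  moreover have "?Q \<inter> P = {}"
    using P by force
  ultimately have "\<exists>u b. u \<noteq> 0 \<and> (\<forall>z\<in>?Q. inner u z \<le> b) \<and> (\<forall>z\<in>P. b \<le> inner u z)"
    using assms(1) False by (intro separating_hyperplane_sets)
  then obtain u b where u: "u \<noteq> 0" and
    Q: "\<And>z. z \<in> ?Q \<Longrightarrow> inner u z \<le> b" and Pb: "\<And>z. z \<in> P \<Longrightarrow> b \<le> inner u z"
    by blast
  obtain a1 a2 where a: "u = (a1, a2)"
    by fastforce
  have Q': "a1 * x + a2 * y \<le> b" if "x < q" "y < q" for x y
    using Q[of "(x, y)"] that by (simp add: a)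
  have "0 \<le> a1"
  proof (rule ccontr)
    assume "\<not> 0 \<le> a1"
    \<comment> \<open>With a negative coefficient, a point of the quadrant far enough to the left
      would violate the bound \<open>b\<close>.\<close>
    define x where "x = min (q - 1) ((b + 1 - a2 * (q - 1)) / a1)"
    have "x \<le> (b + 1 - a2 * (q - 1)) / a1"
      by (simp add: x_def)
    then have "b + 1 - a2 * (q - 1) \<le> a1 * x"
      using \<open>\<not> 0 \<le> a1\<close> by (simp add: neg_le_divide_eq mult.commute)
    moreover have "a1 * x + a2 * (q - 1) \<le> b"
      by (intro Q') (auto simp: x_def)
    ultimately show False
      by simp
  qed
  have "0 \<le> a2"
  proof (rule ccontr)
    assume "\<not> 0 \<le> a2"
    define x where "x = min (q - 1) ((b + 1 - a1 * (q - 1)) / a2)"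
    have "x \<le> (b + 1 - a1 * (q - 1)) / a2"
      by (simp add: x_def)
    then have "b + 1 - a1 * (q - 1) \<le> a2 * x"
      using \<open>\<not> 0 \<le> a2\<close> by (simp add: neg_le_divide_eq mult.commute)
    moreover have "a1 * (q - 1) + a2 * x \<le> b"
      by (intro Q') (auto simp: x_def)
    ultimately show False
      by simp
  qed
  have pos: "0 < a1 + a2"
    using u a \<open>0 \<le> a1\<close> \<open>0 \<le> a2\<close> by (auto simp: zero_prod_def add_nonneg_eq_0_iff less_le)
  \<comment> \<open>The corner \<open>(q, q)\<close> is not in the open quadrant; it is approached
    along the diagonal.\<close>
  have "q \<le> b / (a1 + a2)"
  proof (rule dense_le)
    fix x assume "x < q"
    then have "(a1 + a2) * x \<le> b"
      using Q'[of x x] by (simp add: algebra_simps)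
    then show "x \<le> b / (a1 + a2)"
      using pos by (simp add: field_simps)
  qed
  then have qb: "(a1 + a2) * q \<le> b"
    using pos by (simp add: field_simps)
  define c where "c = a1 / (a1 + a2)"
  have c: "1 - c = a2 / (a1 + a2)"
    using pos by (simp add: c_def field_simps)
  have "0 \<le> c" "c \<le> 1"
    using pos \<open>0 \<le> a1\<close> \<open>0 \<le> a2\<close> by (auto simp: c_def)
  moreover have "q \<le> c * x + (1 - c) * y" if "(x, y) \<in> P" for x y
  proof -
    have "(a1 + a2) * q \<le> a1 * x + a2 * y"
      using Pb[OF that] qb by (simp add: a)
    then have "q \<le> (a1 * x + a2 * y) / (a1 + a2)"
      using pos by (simp add: field_simps)
    then show ?thesis
      by (simp only: c) (simp add: c_def add_divide_distrib)
  qed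
  ultimately show ?thesis
    by blast
qed

text \<open>F(S) is a cone and not a real vector space, so convexity is spelled out. The end points
  are left out because homogeneity in \<open>Lsc\<close> concerns positive scalars.\<close>

definition convex_functionals :: "'a::ordered_semigroup functional set \<Rightarrow> bool"
  where "convex_functionals X \<longleftrightarrow> (\<forall>x\<in>X. \<forall>y\<in>X. \<forall>t::real. 0 < t \<and> t < 1 \<longrightarrow>
    scale_functional (1 - t) x + scale_functional t y \<in> X)"

lemma Lsc_convex_combination:
  assumes "f \<in> Lsc" "0 < t" "t < (1::real)"
  shows "f (scale_functional (1 - t) x + scale_functional t y)
    = ennreal (1 - t) * f x + ennreal t * f y"
  using assms(2,3) by (simp add: Lsc_add[OF assms(1)] Lsc_scale[OF assms(1)])

lemma ennreal_convex_le:
  assumes "0 \<le> t" "t \<le> (1::real)" "a \<le> q" "b \<le> q"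
  shows "ennreal (1 - t) * a + ennreal t * b \<le> q"
proof -
  have "ennreal (1 - t) * a + ennreal t * b \<le> ennreal (1 - t) * q + ennreal t * q"
    using assms by (intro add_mono mult_left_mono) auto
  also have "\<dots> = q"
    using assms by (simp flip: distrib_right ennreal_plus)
  finally show ?thesis .
qed

lemma ennreal_convex_greater:
  assumes "0 < t" "t < (1::real)" "q < a" "q < b"
  shows "q < ennreal (1 - t) * a + ennreal t * b"
proof -
  have "q < min a b"
    using assms by simp
  also have "\<dots> = ennreal (1 - t) * min a b + ennreal t * min a b"
    using assms by (simp flip: distrib_right ennreal_plus)
  also have "\<dots> \<le> ennreal (1 - t) * a + ennreal t * b"
    using assms by (intro add_mono mult_left_mono) auto
  finally show ?thesis .
qed

lemma convex_functionals_sublevel: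
  assumes "convex_functionals X" "f \<in> Lsc"
  shows "convex_functionals {x \<in> X. f x \<le> q}"
  using assms(1) by (auto simp: convex_functionals_def Lsc_convex_combination[OF assms(2)] intro: ennreal_convex_le)

lemma convex_functionals_superlevel:
  assumes "convex_functionals X" "f \<in> Lsc"
  shows "convex_functionals {x \<in> X. q < f x}"
  using assms(1) by (auto simp: convex_functionals_def Lsc_convex_combination[OF assms(2)] intro: ennreal_convex_greater)

lemma convex_image_pair:
  assumes X: "convex_functionals X" and h: "h1 \<in> Lsc" "h2 \<in> Lsc"
    and fin: "\<And>x. x \<in> X \<Longrightarrow> h1 x < top \<and> h2 x < top"
  shows "convex ((\<lambda>x. (enn2real (h1 x), enn2real (h2 x))) ` X)"
  unfolding convex_alt
proof (clarify)
  fix x y and u :: real assume xy: "x \<in> X" "y \<in> X" and u: "0 \<le> u" "u \<le> 1"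
  let ?p = "\<lambda>x. (enn2real (h1 x), enn2real (h2 x))"
  consider "u = 0" | "u = 1" | "0 < u" "u < 1"
    using u by linarith
  then show "(1 - u) *\<^sub>R ?p x + u *\<^sub>R ?p y \<in> ?p ` X"
  proof cases
    case 3
    let ?z = "scale_functional (1 - u) x + scale_functional u y"
    have "enn2real (h ?z) = (1 - u) * enn2real (h x) + u * enn2real (h y)"
      if h: "h \<in> Lsc" "h x < top" "h y < top" for h
      using 3 h(2,3)
      by (simp add: Lsc_convex_combination[OF h(1)] enn2real_plus ennreal_mult_less_top enn2real_mult)
    then have "?p ?z = (1 - u) *\<^sub>R ?p x + u *\<^sub>R ?p y"
      using h fin[OF xy(1)] fin[OF xy(2)] by simp
    moreover have "?z \<in> X"
      using X xy 3 by (simp add: convex_functionals_def)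
    ultimately show ?thesis
      using imageI[of ?z X ?p] by simp
  next
    case 1
    then show ?thesis
      using imageI[OF xy(1), of ?p] by simp
  next
    case 2
    then show ?thesis
      using imageI[OF xy(2), of ?p] by simp
  qed
qed

text \<open>Points where both functions are finite have a convex image in the plane that avoids an
  open quadrant, and separation yields the weights. At the other points any two positive weights
  give the value \<open>top\<close>.\<close>

lemma mix_ge_if_max_ge:
  assumes X: "convex_functionals X" and h: "h1 \<in> Lsc" "h2 \<in> Lsc"
    and q: "0 < q'" "q' < (q::real)"
    and max: "\<And>x. x \<in> X \<Longrightarrow> ennreal q \<le> h1 x \<or> ennreal q \<le> h2 x"
  shows "\<exists>c. 0 \<le> c \<and> c \<le> 1 \<and> (\<forall>x\<in>X. ennreal q' \<le> ennreal c * h1 x + ennreal (1 - c) * h2 x)"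
proof -
  let ?Y = "{x \<in> X. h1 x < top \<and> h2 x < top}"
  let ?P = "(\<lambda>x. (enn2real (h1 x), enn2real (h2 x))) ` ?Y"
  have "convex_functionals ?Y"
    using X by (auto simp: convex_functionals_def Lsc_convex_combination[OF h(1)]
        Lsc_convex_combination[OF h(2)] ennreal_mult_less_top)
  then have "convex ?P"
    using h by (intro convex_image_pair) auto
  moreover have "q \<le> x \<or> q \<le> y" if xy: "(x, y) \<in> ?P" for x y
  proof -
    obtain z where z: "z \<in> X" "h1 z < top" "h2 z < top" "x = enn2real (h1 z)" "y = enn2real (h2 z)"
      using xy by auto
    have "q = enn2real (ennreal q)"
      using q by simp
    then show ?thesis
      using max[OF z(1)] z enn2real_mono[of "ennreal q" "h1 z"] enn2real_mono[of "ennreal q" "h2 z"]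
      by auto
  qed
  ultimately obtain a where a: "0 \<le> a" "a \<le> 1" "\<And>x y. (x, y) \<in> ?P \<Longrightarrow> q \<le> a * x + (1 - a) * y"
    using separate_from_quadrant[of ?P q] by auto
  \<comment> \<open>Chosen so that adding \<open>\<eta>\<close> to both weights and renormalizing
    costs exactly the factor \<open>q / q'\<close>.\<close>
  define \<eta> where "\<eta> = (q / q' - 1) / 2"
  have \<eta>: "0 < \<eta>" "(1 + 2 * \<eta>) * q' = q"
    using q by (auto simp: \<eta>_def field_simps)
  \<comment> \<open>Both weights must be positive, so that points with an infinite value cause no trouble;
    moving \<open>a\<close> into the open interval is what costs the slack between \<open>q'\<close> and \<open>q\<close>.\<close>
  define c where "c = (a + \<eta>) / (1 + 2 * \<eta>)"
  have c': "1 - c = (1 - a + \<eta>) / (1 + 2 * \<eta>)"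
    using \<eta>(1) by (simp add: c_def field_simps)
  have c: "0 < c" "0 < 1 - c"
    unfolding c' using a \<eta>(1) by (auto simp: c_def add_nonneg_pos)
  show ?thesis
  proof (intro exI[of _ c] conjI ballI)
    show "0 \<le> c" "c \<le> 1"
      using c by auto
    fix x assume x: "x \<in> X"
    show "ennreal q' \<le> ennreal c * h1 x + ennreal (1 - c) * h2 x"
    proof (cases "h1 x < top \<and> h2 x < top")
      case True
      then obtain r1 r2 where r: "h1 x = ennreal r1" "h2 x = ennreal r2" "0 \<le> r1" "0 \<le> r2"
        by (cases "h1 x"; cases "h2 x") auto
      have "q \<le> a * r1 + (1 - a) * r2"
        using r x by (intro a(3)) (auto intro!: image_eqI[of _ _ x])
      also have "\<dots> \<le> (a + \<eta>) * r1 + (1 - a + \<eta>) * r2"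
        using r \<eta>(1) by (simp add: algebra_simps)
      also have "\<dots> = (1 + 2 * \<eta>) * (c * r1 + (1 - c) * r2)"
        unfolding c' using \<eta>(1) by (simp add: c_def distrib_left)
      finally have "q' \<le> c * r1 + (1 - c) * r2"
        using \<eta>(1) mult_le_cancel_left_pos[of "1 + 2 * \<eta>" q'] by (simp add: \<eta>(2))
      then show ?thesis
        using c r by (simp add: r flip: ennreal_mult ennreal_plus)
    next
      case False
      then have "h1 x = top \<or> h2 x = top"
        using less_top by blast
      then show ?thesis
        using c by (auto simp: ennreal_mult_top)
    qed
  qed
qed

text \<open>Mixing a small multiple of \<open>x\<close> into \<open>y\<close> makes
  \<open>h1\<close> infinite, so \<open>h2\<close> is at most \<open>q\<close> at the mixture;
  letting the share of \<open>x\<close> tend to 0 gives the bound at \<open>y\<close>.\<close>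

lemma le_if_other_infinite:
  assumes X: "convex_functionals X" and h: "h1 \<in> Lsc" "h2 \<in> Lsc" and "0 \<le> q"
    and min: "\<And>x. x \<in> X \<Longrightarrow> h1 x \<le> ennreal q \<or> h2 x \<le> ennreal q"
    and x: "x \<in> X" "h1 x = top" and y: "y \<in> X"
  shows "h2 y \<le> ennreal q"
proof -
  have *: "ennreal (1 - t) * h2 y \<le> ennreal q" if t: "0 < t" "t < (1::real)" for t
  proof -
    let ?z = "scale_functional (1 - t) y + scale_functional t x"
    have "?z \<in> X"
      using X x y t by (simp add: convex_functionals_def)
    moreover have "h1 ?z = top"
      using t x by (simp add: Lsc_convex_combination[OF h(1)] ennreal_mult_top)
    ultimately have "h2 ?z \<le> ennreal q"
      using min[of ?z] by (auto simp: top_unique)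
    then show ?thesis
      unfolding Lsc_convex_combination[OF h(2) t] by (rule order_trans[rotated]) simp
  qed
  show ?thesis
  proof (cases "h2 y")
    case top
    then show ?thesis
      using *[of "1/2"] by (simp add: ennreal_mult_top top_unique)
  next
    case (real r)
    have "s * r \<le> q" if "0 < s" "s < 1" for s
      using *[of "1 - s"] real that \<open>0 \<le> q\<close> by (simp flip: ennreal_mult)
    then have "r \<le> q"
      by (rule field_le_mult_one_interval)
    then show ?thesis
      using real by (simp add: ennreal_leI)
  qed
qed

text \<open>If one function is infinite somewhere on \<open>X\<close>, the other satisfies the bound
  on all of \<open>X\<close>. Otherwise the negated planar image is separated from a
  quadrant.\<close>

lemma mix_le_if_min_le:
  assumes X: "convex_functionals X" and h: "h1 \<in> Lsc" "h2 \<in> Lsc" and "0 \<le> q"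
    and min: "\<And>x. x \<in> X \<Longrightarrow> h1 x \<le> ennreal q \<or> h2 x \<le> ennreal q"
  shows "\<exists>c. 0 \<le> c \<and> c \<le> 1 \<and> (\<forall>x\<in>X. ennreal c * h1 x + ennreal (1 - c) * h2 x \<le> ennreal q)"
proof -
  consider "\<exists>x\<in>X. h1 x = top" | "\<exists>x\<in>X. h2 x = top" | "\<forall>x\<in>X. h1 x < top \<and> h2 x < top"
    using less_top by blast
  then show ?thesis
  proof cases
    case 1
    then have "\<And>y. y \<in> X \<Longrightarrow> h2 y \<le> ennreal q"
      using le_if_other_infinite[OF X h \<open>0 \<le> q\<close> min] by blast
    \<comment> \<open>Since \<open>0 * top = 0\<close> in \<open>ennreal\<close>, weight 0 removes
      \<open>h1\<close> even where it is infinite.\<close>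
    then show ?thesis
      by (intro exI[of _ 0]) auto
  next
    case 2
    then have "\<And>y. y \<in> X \<Longrightarrow> h1 y \<le> ennreal q"
      using le_if_other_infinite[OF X h(2,1) \<open>0 \<le> q\<close>] min by blast
    then show ?thesis
      by (intro exI[of _ 1]) auto
  next
    case 3
    then have 3: "\<And>x. x \<in> X \<Longrightarrow> h1 x < top \<and> h2 x < top"
      by blast
    let ?P = "(\<lambda>x. (enn2real (h1 x), enn2real (h2 x))) ` X"
    have "convex (uminus ` ?P)"
      using convex_image_pair[OF X h 3] by (rule convex_negations)
    moreover have "- q \<le> x \<or> - q \<le> y" if "(x, y) \<in> uminus ` ?P" for x y
      using that min \<open>0 \<le> q\<close> by (force simp: enn2real_leI)
    ultimately obtain c where c: "0 \<le> c" "c \<le> 1"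
      "\<forall>(x, y)\<in>uminus ` ?P. - q \<le> c * x + (1 - c) * y"
      using separate_from_quadrant[of "uminus ` ?P" "- q"] by blast
    show ?thesis
    proof (intro exI[of _ c] conjI ballI c(1,2))
      fix x assume x: "x \<in> X"
      obtain r1 r2 where r: "h1 x = ennreal r1" "h2 x = ennreal r2" "0 \<le> r1" "0 \<le> r2"
        using 3[OF x] by (cases "h1 x"; cases "h2 x") auto
      have "(- r1, - r2) \<in> uminus ` ?P"
        using x r by (intro image_eqI[of _ _ "(r1, r2)"] image_eqI[of _ _ x]) auto
      then have "c * r1 + (1 - c) * r2 \<le> q"
        using bspec[OF c(3)] by fastforce
      then show "ennreal c * h1 x + ennreal (1 - c) * h2 x \<le> ennreal q"
        using c r by (simp add: ennreal_leI flip: ennreal_mult ennreal_plus)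
    qed
  qed
qed

section \<open>Minimax for finite families, merging two functions at a time\<close>

definition closed_under_mixing :: "('b \<Rightarrow> ennreal) set \<Rightarrow> bool"
  where "closed_under_mixing K \<longleftrightarrow> (\<forall>h1\<in>K. \<forall>h2\<in>K. \<forall>c::real. 0 \<le> c \<and> c \<le> 1 \<longrightarrow>
    (\<lambda>x. ennreal c * h1 x + ennreal (1 - c) * h2 x) \<in> K)"

text \<open>Induction on \<open>H\<close>: the induction hypothesis is applied on the part of
  \<open>X\<close> where the new function \<open>k\<close> is at most \<open>q\<close>, and its
  result is mixed with \<open>k\<close>. Each merge loses some slack, hence the intermediate
  \<open>r\<close> and the generalization over \<open>q'\<close>.\<close>

lemma minimax_max:
  assumes "finite H" "H \<noteq> {}" "H \<subseteq> K" and K: "K \<subseteq> Lsc" "closed_under_mixing K"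
    and "convex_functionals X" "0 < q'" "q' < (q::real)"
    and "\<And>x. x \<in> X \<Longrightarrow> \<exists>h\<in>H. ennreal q < h x"
  shows "\<exists>h\<in>K. \<forall>x\<in>X. ennreal q' \<le> h x"
  using assms(1-3,6-)
proof (induction H arbitrary: X q' rule: finite_ne_induct)
  case (singleton h)
  have "ennreal q' \<le> h x" if "x \<in> X" for x
    using singleton(5)[OF that] ennreal_leI[of q' q] singleton(4) by auto
  then show ?case
    using singleton by blast
next
  case (insert k H)
  obtain r where r: "q' < r" "r < q"
    using dense[OF insert.prems(4)] by auto
  have k: "k \<in> K" "k \<in> Lsc"
    using insert.prems K by auto
  let ?Y = "{x \<in> X. k x \<le> ennreal q}"
  have "\<exists>h\<in>K. \<forall>x\<in>?Y. ennreal r \<le> h x"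
  proof (rule insert.IH)
    show "\<exists>h\<in>H. ennreal q < h x" if "x \<in> ?Y" for x
      using insert.prems(5)[of x] that by auto
  qed (use insert.prems r k convex_functionals_sublevel in auto)
  then obtain h where h: "h \<in> K" "\<And>x. x \<in> ?Y \<Longrightarrow> ennreal r \<le> h x"
    by blast
  have "ennreal r \<le> k x \<or> ennreal r \<le> h x" if "x \<in> X" for x
  proof (cases "k x \<le> ennreal q")
    case True
    then show ?thesis using h(2) that by simp
  next
    case False
    then show ?thesis
      using r by (meson ennreal_leI less_imp_le not_le order_trans)
  qed
  then obtain c where "0 \<le> c" "c \<le> 1"
    "\<And>x. x \<in> X \<Longrightarrow> ennreal q' \<le> ennreal c * k x + ennreal (1 - c) * h x"
    using mix_ge_if_max_ge[OF insert.prems(2) k(2) subsetD[OF K(1) h(1)] insert.prems(3) r(1)] by auto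
  then show ?case
    using K(2) k(1) h(1) unfolding closed_under_mixing_def
    by (intro bexI[of _ "\<lambda>x. ennreal c * k x + ennreal (1 - c) * h x"]) auto
qed

text \<open>Dual to \<open>minimax_max\<close>, with the induction hypothesis applied where
  \<open>k\<close> exceeds \<open>q\<close>; merging costs no slack here.\<close>

lemma minimax_min:
  assumes "finite H" "H \<noteq> {}" "H \<subseteq> K" and K: "K \<subseteq> Lsc" "closed_under_mixing K"
    and "convex_functionals X" and q: "0 \<le> (q::real)"
    and "\<And>x. x \<in> X \<Longrightarrow> \<exists>h\<in>H. h x \<le> ennreal q"
  shows "\<exists>h\<in>K. \<forall>x\<in>X. h x \<le> ennreal q"
  using assms(1-3,6,8)
proof (induction H arbitrary: X rule: finite_ne_induct)
  case (singleton h)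
  then show ?case
    by blast
next
  case (insert k H)
  have k: "k \<in> K" "k \<in> Lsc"
    using insert.prems K by auto
  let ?Y = "{x \<in> X. ennreal q < k x}"
  have "\<exists>h\<in>K. \<forall>x\<in>?Y. h x \<le> ennreal q"
  proof (rule insert.IH)
    show "\<exists>h\<in>H. h x \<le> ennreal q" if "x \<in> ?Y" for x
      using insert.prems(3)[of x] that by auto
  qed (use insert.prems k convex_functionals_superlevel in auto)
  then obtain h where h: "h \<in> K" "\<And>x. x \<in> ?Y \<Longrightarrow> h x \<le> ennreal q"
    by blast
  then have "k x \<le> ennreal q \<or> h x \<le> ennreal q" if "x \<in> X" for x
    using that by force
  then obtain c where "0 \<le> c" "c \<le> 1"
    "\<And>x. x \<in> X \<Longrightarrow> ennreal c * k x + ennreal (1 - c) * h x \<le> ennreal q"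
    using mix_le_if_min_le[OF insert.prems(2) k(2) subsetD[OF K(1) h(1)] q] by auto
  then show ?case
    using K(2) k(1) h(1) unfolding closed_under_mixing_def
    by (intro bexI[of _ "\<lambda>x. ennreal c * k x + ennreal (1 - c) * h x"]) auto
qed

section \<open>Interpolation by multiples of elements\<close>

inductive_set hat_cone :: "('a::cu_semigroup functional \<Rightarrow> ennreal) set" where
  hat: "hat s \<in> hat_cone"
| scale: "h \<in> hat_cone \<Longrightarrow> 0 \<le> c \<Longrightarrow> (\<lambda>x. ennreal c * h x) \<in> hat_cone"
| add: "h1 \<in> hat_cone \<Longrightarrow> h2 \<in> hat_cone \<Longrightarrow> (\<lambda>x. h1 x + h2 x) \<in> hat_cone"

lemma hat_cone_subset_Lsc: "hat_cone \<subseteq> Lsc"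
proof
  show "h \<in> Lsc" if "h \<in> hat_cone" for h :: "'a functional \<Rightarrow> ennreal"
    using that by induction (auto simp: hat_in_Lsc Lsc_cmult Lsc_plus)
qed

lemma hat_cone_mix:
  "h1 \<in> hat_cone \<Longrightarrow> h2 \<in> hat_cone \<Longrightarrow> 0 \<le> c \<Longrightarrow> c \<le> 1 \<Longrightarrow>
    (\<lambda>x. ennreal c * h1 x + ennreal (1 - c) * h2 x) \<in> hat_cone"
  by (intro hat_cone.intros) auto

section \<open>Replacing real coefficients by rational ones\<close>

lemma apply_sum: "apply_functional l (\<Sum>i\<in>A. s i) = (\<Sum>i\<in>A. apply_functional l (s i))"
  by (induction A rule: infinite_finite_induct) (auto simp: apply_add apply_zero)

lemma divide_of_nat_ennreal:
  assumes "0 < n"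
  shows "(a :: ennreal) / of_nat n = ennreal (1 / real n) * a"
  using assms by (simp add: divide_ennreal_def inverse_ennreal inverse_eq_divide mult.commute ennreal_of_nat_eq_real_of_nat)

lemma nat_fraction_between:
  assumes "0 \<le> a" "a < (b::real)"
  obtains p m :: nat where "0 < m" "a < real p / real m" "real p / real m < b"
proof -
  obtain r where r: "r \<in> \<rat>" "a < r" "r < b"
    using Rats_dense_in_real[OF assms(2)] by blast
  then obtain p m :: nat where "m \<noteq> 0" "\<bar>r\<bar> = real p / real m"
    using Rats_abs_nat_div_natE by metis
  then show ?thesis
    using r assms(1) by (intro that[of m p]) auto
qed

text \<open>The factor \<open>\<kappa> < 1\<close> leaves room to lower each real coefficient to a
  fraction \<open>p / m\<close>; \<open>p\<close> copies of an element realize the numerator, and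
  sums are brought to a common denominator.\<close>

lemma hat_cone_approx:
  fixes h :: "'a::cu_semigroup functional \<Rightarrow> ennreal"
  assumes "h \<in> hat_cone" "0 < \<kappa>" "\<kappa> < (1::real)"
  shows "\<exists>s n. 0 < n \<and> (\<forall>x. ennreal \<kappa> * h x \<le> hat s x / of_nat n \<and> hat s x / of_nat n \<le> h x)"
  using assms
proof (induction h arbitrary: \<kappa>)
  case (hat s)
  have "ennreal \<kappa> * hat s x \<le> 1 * hat s x" for x
    using hat by (intro mult_right_mono) auto
  moreover have "hat s x / of_nat 1 = hat s x" for x
    using divide_of_nat_ennreal[of 1 "hat s x"] by simp
  ultimately show ?case
    by (intro exI[of _ s] exI[of _ 1]) (simp only: mult_1_left order_refl zero_less_one simp_thms)
next
  case (scale h c)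
  \<comment> \<open>The slack is shared: \<open>\<kappa>'\<close> is spent on \<open>h\<close>, and
    the quotient \<open>\<kappa> / \<kappa>'\<close> on the coefficient \<open>c\<close>.\<close>
  obtain \<kappa>' where \<kappa>': "\<kappa> < \<kappa>'" "\<kappa>' < 1"
    using dense[OF scale.prems(2)] by blast
  have "0 < \<kappa>'"
    using scale.prems(1) \<kappa>'(1) by simp
  obtain s n where s: "0 < n" "\<And>x. ennreal \<kappa>' * h x \<le> hat s x / of_nat n"
    "\<And>x. hat s x / of_nat n \<le> h x"
    using scale.IH[OF \<open>0 < \<kappa>'\<close> \<kappa>'(2)] by blast
  show ?case
  proof (cases "c = 0")
    case True
    then show ?thesis
      by (intro exI[of _ 0] exI[of _ 1]) (simp add: hat_def apply_zero)
  next
    case False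
    then have "\<kappa> / \<kappa>' * c < c"
      using scale \<kappa>' by (simp add: field_simps)
    moreover have "0 \<le> \<kappa> / \<kappa>' * c"
      using scale \<kappa>' by simp
    ultimately obtain p m :: nat where pm: "0 < m" "\<kappa> / \<kappa>' * c < real p / real m" "real p / real m < c"
      using nat_fraction_between by blast
    have eq: "hat (\<Sum>i<p. s) x / of_nat (m * n) = ennreal (real p / real m) * (hat s x / of_nat n)" for x
      using pm(1) s(1) unfolding divide_of_nat_ennreal[OF s(1)]
        divide_of_nat_ennreal[OF mult_pos_pos[OF pm(1) s(1)]]
      by (simp add: hat_def apply_sum ennreal_of_nat_eq_real_of_nat flip: ennreal_mult mult.assoc)
    have "ennreal \<kappa> * (ennreal c * h x) \<le> ennreal (real p / real m) * (hat s x / of_nat n)" for x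
    proof -
      have "\<kappa> * c \<le> (real p / real m) * \<kappa>'"
        using pm \<kappa>' scale.prems by (simp add: field_simps)
      then have "ennreal (\<kappa> * c) * h x \<le> ennreal ((real p / real m) * \<kappa>') * h x"
        by (intro mult_right_mono ennreal_leI) auto
      also have "\<dots> = ennreal (real p / real m) * (ennreal \<kappa>' * h x)"
        using \<open>0 < \<kappa>'\<close> by (subst ennreal_mult) (auto simp: mult.assoc)
      also have "\<dots> \<le> ennreal (real p / real m) * (hat s x / of_nat n)"
        by (intro mult_left_mono s) auto
      finally show ?thesis
        using scale by (simp add: ennreal_mult mult.assoc)
    qed
    moreover have "ennreal (real p / real m) * (hat s x / of_nat n) \<le> ennreal c * h x" for x
      using pm by (intro mult_mono s ennreal_leI) auto
    ultimately show ?thesis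
      using pm(1) s(1) by (intro exI[of _ "\<Sum>i<p. s"] exI[of _ "m * n"]) (simp only: eq, simp)
  qed
next
  case (add h1 h2)
  obtain s1 n1 where s1: "0 < n1" "\<And>x. ennreal \<kappa> * h1 x \<le> hat s1 x / of_nat n1"
    "\<And>x. hat s1 x / of_nat n1 \<le> h1 x"
    using add.IH(1)[OF add.prems] by blast
  obtain s2 n2 where s2: "0 < n2" "\<And>x. ennreal \<kappa> * h2 x \<le> hat s2 x / of_nat n2"
    "\<And>x. hat s2 x / of_nat n2 \<le> h2 x"
    using add.IH(2)[OF add.prems] by blast
  let ?s = "(\<Sum>i<n2. s1) + (\<Sum>i<n1. s2)"
  have eq: "hat ?s x / of_nat (n1 * n2) = hat s1 x / of_nat n1 + hat s2 x / of_nat n2" for x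
    using s1(1) s2(1) unfolding divide_of_nat_ennreal[OF s1(1)] divide_of_nat_ennreal[OF s2(1)]
      divide_of_nat_ennreal[OF mult_pos_pos[OF s1(1) s2(1)]]
    by (simp add: hat_def apply_sum apply_add distrib_left ennreal_of_nat_eq_real_of_nat
        flip: ennreal_mult mult.assoc)
  have "ennreal \<kappa> * (h1 x + h2 x) \<le> hat s1 x / of_nat n1 + hat s2 x / of_nat n2" for x
    unfolding distrib_left by (intro add_mono s1 s2)
  moreover have "hat s1 x / of_nat n1 + hat s2 x / of_nat n2 \<le> h1 x + h2 x" for x
    by (intro add_mono s1 s2)
  ultimately show ?case
    using s1(1) s2(1) by (intro exI[of _ ?s] exI[of _ "n1 * n2"]) (simp only: eq, simp)
qed

text \<open>By \<open>Lsc_mono\<close> some \<open>s\<close> has a smaller value at \<open>m\<close>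
  than at \<open>l\<close>. Passing to \<open>x n \<lless> s\<close> keeps the gap and makes the
  upper bound hold on a neighbourhood of \<open>m\<close>; division by a number inside the gap moves
  the threshold to 1.\<close>

lemma separating_hat:
  fixes l m :: "'a::cu_semigroup functional"
  assumes "g \<in> Lsc" "g m < g l"
  shows "\<exists>h\<in>hat_cone. 1 < h l \<and> (\<exists>V. open V \<and> m \<in> V \<and> (\<forall>x\<in>V. h x \<le> 1))"
proof -
  have "\<not> (\<forall>s. apply_functional l s \<le> apply_functional m s)"
    using Lsc_mono[OF assms(1), of l m] assms(2) leD by blast
  then obtain s where s: "apply_functional m s < apply_functional l s"
    by (auto simp: not_le)
  obtain x where x: "incseq x" "has_sup x s" "\<And>n. x n \<lless> s"
    using rapid_sequence[of s] by auto
  obtain n where n: "apply_functional m s < apply_functional l (x n)"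
    using s unfolding apply_has_sup[OF x(1,2), of l] less_SUP_iff by blast
  obtain r where r: "apply_functional m s < r" "r < apply_functional l (x n)"
    using dense[OF n] by blast
  have "0 < r"
    using zero_le r(1) by (rule le_less_trans)
  moreover have "r < top"
    using r(2) top_greatest by (rule less_le_trans)
  ultimately obtain c where c: "r = ennreal c" "0 < c"
    by (cases r) auto
  let ?h = "\<lambda>y. ennreal (1 / c) * hat (x n) y"
  have one: "ennreal (1 / c) * r = 1"
    using c by (simp flip: ennreal_mult)
  obtain V where V: "open V" "m \<in> V" "\<And>y. y \<in> V \<Longrightarrow> apply_functional y (x n) < r"
    using eventually_apply_less[OF x(3)[of n] r(1)] unfolding eventually_nhds by blast
  have "?h y \<le> 1" if "y \<in> V" for y
  proof -
    have "?h y \<le> ennreal (1 / c) * r"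
      using V(3)[OF that] by (intro mult_left_mono) (auto simp: hat_def)
    then show ?thesis
      by (simp only: one)
  qed
  moreover have "1 < ?h l"
  proof -
    have "ennreal (1 / c) * r < ?h l"
      using r c unfolding hat_def by (intro ennreal_mult_strict_left_mono) auto
    then show ?thesis
      by (simp only: one)
  qed
  moreover have "?h \<in> hat_cone"
    using c by (intro hat_cone.intros) auto
  ultimately show ?thesis
    using V(1,2) by (intro bexI[of _ ?h] conjI exI[of _ V] ballI) auto
qed

text \<open>Compactness of \<open>{g \<le> \<theta>}\<close> leaves finitely many separating
  functions, at least one of which is at most 1 at each point of that set. Exceeding 1 at
  \<open>l\<close> survives mixing, so \<open>minimax_min\<close> merges them into one.\<close>

lemma hat_cone_below:
  fixes g :: "'a::cu_semigroup functional \<Rightarrow> ennreal"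
  assumes g: "g \<in> Lsc" and l: "ennreal \<theta> < g l"
  shows "\<exists>h\<in>hat_cone. 1 < h l \<and> (\<forall>x. g x \<le> ennreal \<theta> \<longrightarrow> h x \<le> 1)"
proof -
  let ?B = "{x. g x \<le> ennreal \<theta>}"
  have "?B = - {x. ennreal \<theta> < g x}"
    by auto
  then have "closed ?B"
    using Lsc_lower_semicontinuous[OF g] by (simp add: lower_semicontinuous_def closed_Compl)
  then have "compact ?B"
    using compact_Int_closed[OF compact_functional, of ?B] by simp
  have "\<forall>m\<in>?B. \<exists>h V. h \<in> hat_cone \<and> 1 < h l \<and> open V \<and> m \<in> V \<and> (\<forall>x\<in>V. h x \<le> 1)"
  proof
    fix m assume "m \<in> ?B"
    then have "g m < g l"
      using l by auto
    then show "\<exists>h V. h \<in> hat_cone \<and> 1 < h l \<and> open V \<and> m \<in> V \<and> (\<forall>x\<in>V. h x \<le> 1)"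
      using separating_hat[OF g] by blast
  qed
  then obtain h V where hV: "\<forall>m\<in>?B. h m \<in> hat_cone \<and> 1 < h m l \<and> open (V m) \<and> m \<in> V m \<and>
      (\<forall>x\<in>V m. h m x \<le> 1)"
    unfolding bchoice_iff by (elim exE) (rule that)
  obtain N where N: "N \<subseteq> ?B" "finite N" "?B \<subseteq> (\<Union>m\<in>N. V m)"
    by (rule compactE_image[OF \<open>compact ?B\<close>, of ?B V]) (use hV in auto)
  let ?K = "{h \<in> hat_cone. 1 < h l}"
  have "\<exists>k\<in>?K. \<forall>x\<in>?B. k x \<le> ennreal 1"
  proof (rule minimax_min)
    \<comment> \<open>Ensures that the finite subcover is nonempty, as the minimax lemma
      requires.\<close>
    have "0 \<in> ?B"
      by (simp add: Lsc_zero[OF g])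
    then show "h ` N \<noteq> {}"
      using N by auto
    show "finite (h ` N)" "h ` N \<subseteq> ?K"
      using N hV by auto
    show "?K \<subseteq> Lsc"
      using hat_cone_subset_Lsc by blast
    show "closed_under_mixing ?K"
      unfolding closed_under_mixing_def
    proof (intro ballI allI impI)
      fix h1 h2 and c :: real
      assume h: "h1 \<in> ?K" "h2 \<in> ?K" and c: "0 \<le> c \<and> c \<le> 1"
      have "1 < ennreal c * h1 l + ennreal (1 - c) * h2 l"
        using ennreal_convex_greater[of "1 - c" 1 "h1 l" "h2 l"] h c
        by (cases "c = 0 \<or> c = 1") auto
      then show "(\<lambda>x. ennreal c * h1 x + ennreal (1 - c) * h2 x) \<in> ?K"
        using h c hat_cone_mix[of h1 h2 c] by simp
    qed
    show "convex_functionals ?B"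
      using convex_functionals_sublevel[of UNIV g] g by (simp add: convex_functionals_def)
    show "\<exists>k\<in>h ` N. k x \<le> ennreal 1" if "x \<in> ?B" for x
      using subsetD[OF N(3) that] hV N(1) by fastforce
  qed simp
  then show ?thesis
    by auto
qed

text \<open>
  The functions of the cone lying below \<open>g / \<theta>\<close> are closed under mixing, and finitely many of them
  exceed 1 somewhere on the compact closure of \<open>{f > 1}\<close>, so a mixture exceeds \<open>f\<close> up to the slack
  contained in \<open>\<theta>\<close>.
\<close>

lemma hat_between:
  fixes f g :: "'a::cu_semigroup functional \<Rightarrow> ennreal"
  assumes f: "f \<in> Lsc" and g: "g \<in> Lsc" and fg: "f \<lhd> g"
  shows "\<exists>s n. 0 < n \<and> (\<forall>x. f x \<le> hat s x / of_nat n \<and> hat s x / of_nat n \<le> g x)"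
proof -
  let ?A = "closure {x. 1 < f x}"
  obtain \<theta> :: real where \<theta>: "1 < \<theta>" "?A \<subseteq> {x. ennreal \<theta> < g x}"
    using closure_superlevel_strongly_below[OF fg] by auto
  have "compact ?A"
    using compact_Int_closed[OF compact_functional, of ?A] by simp
  let ?K = "{h \<in> hat_cone. \<forall>x. g x \<le> ennreal \<theta> \<longrightarrow> h x \<le> 1}"
  have "\<forall>l\<in>?A. \<exists>h. h \<in> ?K \<and> 1 < h l"
  proof
    fix l assume "l \<in> ?A"
    then have "ennreal \<theta> < g l"
      using \<theta>(2) by auto
    then show "\<exists>h. h \<in> ?K \<and> 1 < h l"
      using hat_cone_below[OF g, of \<theta> l] by blast
  qed
  then have "\<exists>h. \<forall>l\<in>?A. h l \<in> ?K \<and> 1 < h l l"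
    by (rule bchoice)
  then obtain h where h: "\<And>l. l \<in> ?A \<Longrightarrow> h l \<in> ?K" "\<And>l. l \<in> ?A \<Longrightarrow> 1 < h l l"
    by blast
  have "open {x. 1 < h l x}" if "l \<in> ?A" for l
  proof -
    have "h l \<in> Lsc"
      using h(1)[OF that] hat_cone_subset_Lsc by auto
    then show ?thesis
      using Lsc_lower_semicontinuous by (auto simp: lower_semicontinuous_def)
  qed
  moreover have "?A \<subseteq> (\<Union>l\<in>?A. {x. 1 < h l x})"
    using h(2) by auto
  ultimately obtain N where N: "N \<subseteq> ?A" "finite N" "?A \<subseteq> (\<Union>l\<in>N. {x. 1 < h l x})"
    by (rule compactE_image[OF \<open>compact ?A\<close>, of ?A "\<lambda>l. {x. 1 < h l x}"])
  \<comment> \<open>The final element must fit between \<open>k / q\<close> and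
    \<open>\<theta> * k\<close>; \<open>1 / \<theta> < q\<close> leaves the factor
    \<open>1 / (\<theta> * q) < 1\<close> for the rational approximation.\<close>
  obtain q where q: "1 / \<theta> < q" "q < 1"
    using dense[of "1 / \<theta>" 1] \<theta>(1) by auto
  have "0 < q"
    using less_trans[OF _ q(1)] \<theta>(1) by simp
  have "\<exists>k\<in>?K. \<forall>x\<in>{x. 1 < f x}. ennreal q \<le> k x"
  proof (rule minimax_max[where q = 1])
    \<comment> \<open>The zero function is added in case \<open>?A\<close>, and with it
      \<open>N\<close>, is empty.\<close>
    have "hat 0 \<in> ?K"
      using hat_cone.hat[of 0] by (simp add: hat_def apply_zero)
    moreover have "h ` N \<subseteq> ?K"
      using N(1) h(1) by blast
    ultimately show "insert (hat 0) (h ` N) \<subseteq> ?K"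
      by simp
    show "finite (insert (hat 0) (h ` N))" "insert (hat 0) (h ` N) \<noteq> {}"
      using N by auto
    show "?K \<subseteq> Lsc"
      using hat_cone_subset_Lsc by blast
    show "closed_under_mixing ?K"
      unfolding closed_under_mixing_def
    proof (intro ballI allI impI)
      fix h1 h2 and c :: real
      assume h: "h1 \<in> ?K" "h2 \<in> ?K" and c: "0 \<le> c \<and> c \<le> 1"
      have "ennreal c * h1 x + ennreal (1 - c) * h2 x \<le> 1" if "g x \<le> ennreal \<theta>" for x
        using ennreal_convex_le[of "1 - c" "h1 x" 1 "h2 x"] h c that by auto
      then show "(\<lambda>x. ennreal c * h1 x + ennreal (1 - c) * h2 x) \<in> ?K"
        using h c hat_cone_mix[of h1 h2 c] by simp
    qed
    show "convex_functionals {x. 1 < f x}"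
      using convex_functionals_superlevel[of UNIV f 1] f by (simp add: convex_functionals_def)
    show "\<exists>k\<in>insert (hat 0) (h ` N). ennreal 1 < k x" if "x \<in> {x. 1 < f x}" for x
      using subsetD[OF N(3) subsetD[OF closure_subset that]] by auto
  qed (use q \<open>0 < q\<close> in auto)
  then obtain k where k: "k \<in> hat_cone" "\<And>x. g x \<le> ennreal \<theta> \<Longrightarrow> k x \<le> 1"
    "\<And>x. 1 < f x \<Longrightarrow> ennreal q \<le> k x"
    by auto
  have kL: "k \<in> Lsc"
    using k(1) hat_cone_subset_Lsc by blast
  have fk: "ennreal q * f x \<le> k x" for x
    using Lsc_le_if_superlevel_le[OF f kL \<open>0 < q\<close>] k(3) by blast
  have kg: "ennreal \<theta> * k x \<le> g x" for x
  proof (rule Lsc_le_if_superlevel_le[OF kL g])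
    show "0 < \<theta>" using \<theta>(1) by simp
    show "ennreal \<theta> \<le> g y" if "1 < k y" for y
      using k(2)[of y] that by force
  qed
  have \<kappa>: "0 < 1 / (\<theta> * q)" "1 / (\<theta> * q) < 1"
    using q \<theta>(1) \<open>0 < q\<close> by (auto simp: field_simps)
  have "(\<lambda>x. ennreal \<theta> * k x) \<in> hat_cone"
    using k(1) \<theta>(1) by (intro hat_cone.intros) auto
  from hat_cone_approx[OF this \<kappa>] obtain s n where s: "0 < n"
    "\<And>x. ennreal (1 / (\<theta> * q)) * (ennreal \<theta> * k x) \<le> hat s x / of_nat n"
    "\<And>x. hat s x / of_nat n \<le> ennreal \<theta> * k x"
    by blast
  have "f x \<le> hat s x / of_nat n" for x
  proof -
    have "f x = ennreal (1 / q) * (ennreal q * f x)"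
      using \<open>0 < q\<close> by (simp flip: ennreal_mult mult.assoc)
    also have "\<dots> \<le> ennreal (1 / q) * k x"
      by (intro mult_left_mono fk) auto
    also have "\<dots> = ennreal (1 / (\<theta> * q)) * (ennreal \<theta> * k x)"
      using \<theta>(1) \<open>0 < q\<close> by (simp flip: ennreal_mult mult.assoc)
    also have "\<dots> \<le> hat s x / of_nat n"
      by (rule s(2))
    finally show ?thesis .
  qed
  moreover have "hat s x / of_nat n \<le> g x" for x
    using s(3) kg by (rule order_trans)
  ultimately show ?thesis
    using s(1) by blast
qed

text \<open>Elements inserted between consecutive \<open>g i\<close> interleave with them, so they
  increase and have the same supremum.\<close>

lemma L_F_subset_S_R: "L_F \<subseteq> (S_R :: ('a::cu_semigroup functional \<Rightarrow> ennreal) set)"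
proof
  fix f :: "'a functional \<Rightarrow> ennreal" assume "f \<in> L_F"
  then obtain g where f: "f \<in> Lsc" "\<And>l. f l = (SUP n. g n l)"
    and g: "\<And>n. g n \<in> Lsc" "\<And>n. g n \<lhd> g (Suc n)"
    unfolding L_F_def by blast
  have "\<forall>i. \<exists>s n. 0 < n \<and> (\<forall>x. g i x \<le> hat s x / of_nat n \<and> hat s x / of_nat n \<le> g (Suc i) x)"
    using hat_between[OF g(1) g(1) g(2)] by blast
  then obtain s n where n: "\<And>i. 0 < n i"
    and s: "\<And>i x. g i x \<le> hat (s i) x / of_nat (n i)" "\<And>i x. hat (s i) x / of_nat (n i) \<le> g (Suc i) x"
    by metis
  have "incseq (\<lambda>i l. hat (s i) l / of_nat (n i))"
    by (intro incseq_SucI le_funI order_trans[OF s(2) s(1)])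
  moreover have "f l = (SUP i. hat (s i) l / of_nat (n i))" for l
    unfolding f(2) by (intro antisym SUP_mono) (use s in blast)+
  ultimately show "f \<in> S_R"
    unfolding S_R_def using f(1) n by blast
qed

section \<open>Continuous functions between elements\<close>

definition interpolant :: "'a::cu_semigroup \<Rightarrow> 'a \<Rightarrow> 'a"
  where "interpolant a b = (SOME r. a \<lless> r \<and> r \<lless> b)"

lemma interpolant:
  assumes "a \<lless> b"
  shows "a \<lless> interpolant a b" "interpolant a b \<lless> b"
proof -
  have "\<exists>r. a \<lless> r \<and> r \<lless> b"
    using way_below_interpolate[OF assms] by auto
  then have "a \<lless> interpolant a b \<and> interpolant a b \<lless> b"
    unfolding interpolant_def by (rule someI_ex)
  then show "a \<lless> interpolant a b" "interpolant a b \<lless> b"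
    by auto
qed

text \<open>Index \<open>i\<close> at level \<open>n\<close> stands for the dyadic number
  \<open>i / 2 ^ n\<close>; only indices up to \<open>2 ^ n\<close> are meaningful.\<close>

primrec dyadic_chain :: "'a::cu_semigroup \<Rightarrow> 'a \<Rightarrow> nat \<Rightarrow> nat \<Rightarrow> 'a" where
  "dyadic_chain a b 0 i = (if i = 0 then a else b)"
| "dyadic_chain a b (Suc n) i = (if even i then dyadic_chain a b n (i div 2)
     else interpolant (dyadic_chain a b n (i div 2)) (dyadic_chain a b n (Suc (i div 2))))"

lemma dyadic_chain_way_below:
  assumes "a \<lless> b"
  shows "i < 2 ^ n \<Longrightarrow> dyadic_chain a b n i \<lless> dyadic_chain a b n (Suc i)"
proof (induction n arbitrary: i)
  case 0
  then show ?case
    using assms by simp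
next
  case (Suc n)
  have "i div 2 < 2 ^ n"
    using Suc.prems by auto
  from interpolant[OF Suc.IH[OF this]] show ?case
    by (cases "even i") auto
qed

lemma dyadic_chain_top: "dyadic_chain a b n (2 ^ n) = b"
  by (induction n) auto

lemma dyadic_chain_le_top:
  assumes "a \<lless> b" "i \<le> 2 ^ n"
  shows "dyadic_chain a b n i \<le> b"
  using assms(2)
proof (induction rule: inc_induct)
  case base
  then show ?case
    by (simp add: dyadic_chain_top)
next
  case (step i)
  then show ?case
    using way_below_le[OF dyadic_chain_way_below[OF assms(1)]] order_trans by blast
qed

section \<open>Riemann sums along dyadic chains\<close>

lemma sum_even_odd:
  fixes u :: "nat \<Rightarrow> 'b::comm_monoid_add"
  shows "(\<Sum>i<2 * n. u i) = (\<Sum>j<n. u (2 * j) + u (Suc (2 * j)))"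
  by (induction n) (auto simp: add.assoc)

text \<open>Telescoping, stated without subtraction so that it holds in
  \<open>ennreal\<close>.\<close>

lemma sum_shift_two:
  fixes u :: "nat \<Rightarrow> 'b::comm_monoid_add"
  shows "(\<Sum>i<n. u (Suc (Suc i))) + (u 0 + u 1) = (\<Sum>i<n. u i) + (u n + u (Suc n))"
  by (induction n) (auto simp: ac_simps)

definition lower_sum :: "'a::cu_semigroup \<Rightarrow> 'a \<Rightarrow> nat \<Rightarrow> 'a functional \<Rightarrow> ennreal"
  where "lower_sum a b n l = ennreal (1 / 2 ^ n) * (\<Sum>i<2 ^ n. apply_functional l (dyadic_chain a b n i))"

definition upper_sum :: "'a::cu_semigroup \<Rightarrow> 'a \<Rightarrow> nat \<Rightarrow> 'a functional \<Rightarrow> ennreal"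
  where "upper_sum a b n l = ennreal (1 / 2 ^ n) * (\<Sum>i<2 ^ n. apply_functional l (dyadic_chain a b n (Suc i)))"

lemma lower_sum_in_Lsc: "lower_sum a b n \<in> Lsc"
proof -
  have "lower_sum a b n = (\<lambda>l. ennreal (1 / 2 ^ n) * hat (\<Sum>i<2 ^ n. dyadic_chain a b n i) l)"
    by (simp add: lower_sum_def hat_def apply_sum fun_eq_iff)
  then show ?thesis
    by (simp add: Lsc_cmult hat_in_Lsc)
qed

lemma ennreal_half_double: "ennreal (1 / 2 ^ n) * x = ennreal (1 / 2 ^ Suc n) * (x + x)"
proof -
  have "ennreal (1 / 2 ^ n) = ennreal (1 / 2 ^ Suc n) + ennreal (1 / 2 ^ Suc n)"
    by (simp flip: ennreal_plus)
  then show ?thesis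
    by (simp add: distrib_left distrib_right)
qed

lemma lower_sum_le_Suc:
  assumes "a \<lless> b"
  shows "lower_sum a b n l \<le> lower_sum a b (Suc n) l"
proof -
  let ?u = "\<lambda>n i. apply_functional l (dyadic_chain a b n i)"
  have "?u n i + ?u n i \<le> ?u (Suc n) (2 * i) + ?u (Suc n) (Suc (2 * i))" if "i < 2 ^ n" for i
    using way_below_le[OF interpolant(1)[OF dyadic_chain_way_below[OF assms that]]]
    by (auto intro!: add_mono apply_mono)
  then have "(\<Sum>i<2 ^ n. ?u n i) + (\<Sum>i<2 ^ n. ?u n i) \<le> (\<Sum>i<2 ^ Suc n. ?u (Suc n) i)"
    unfolding power_Suc sum_even_odd sum.distrib[symmetric] by (intro sum_mono) auto
  then show ?thesis
    unfolding lower_sum_def ennreal_half_double[of n] by (intro mult_left_mono) auto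
qed

lemma upper_sum_Suc_le:
  assumes "a \<lless> b"
  shows "upper_sum a b (Suc n) l \<le> upper_sum a b n l"
proof -
  let ?u = "\<lambda>n i. apply_functional l (dyadic_chain a b n i)"
  have "?u (Suc n) (Suc (2 * i)) + ?u (Suc n) (Suc (Suc (2 * i))) \<le> ?u n (Suc i) + ?u n (Suc i)"
    if "i < 2 ^ n" for i
    using way_below_le[OF interpolant(2)[OF dyadic_chain_way_below[OF assms that]]]
    by (auto intro!: add_mono apply_mono)
  then have "(\<Sum>i<2 ^ Suc n. ?u (Suc n) (Suc i)) \<le> (\<Sum>i<2 ^ n. ?u n (Suc i)) + (\<Sum>i<2 ^ n. ?u n (Suc i))"
    unfolding power_Suc sum_even_odd sum.distrib[symmetric] by (intro sum_mono) auto
  then show ?thesis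
    unfolding upper_sum_def ennreal_half_double[of n] by (intro mult_left_mono) auto
qed

lemma lower_sum_le_upper_sum:
  assumes "a \<lless> b"
  shows "lower_sum a b m l \<le> upper_sum a b n l"
proof -
  let ?k = "max m n"
  have "incseq (\<lambda>n. lower_sum a b n l)" "decseq (\<lambda>n. upper_sum a b n l)"
    using assms by (auto intro: incseq_SucI decseq_SucI lower_sum_le_Suc upper_sum_Suc_le)
  then have "lower_sum a b m l \<le> lower_sum a b ?k l" "upper_sum a b ?k l \<le> upper_sum a b n l"
    by (auto simp: incseq_def decseq_def)
  moreover have "lower_sum a b ?k l \<le> upper_sum a b ?k l"
    unfolding lower_sum_def upper_sum_def
    by (intro mult_left_mono sum_mono apply_mono way_below_le[OF dyadic_chain_way_below[OF assms]]) auto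
  ultimately show ?thesis
    by (meson order_trans)
qed

text \<open>Near \<open>l\<close>, each value of \<open>m\<close> in the upper sum is bounded by the
  value of \<open>l\<close> one chain step further. This is the lower sum of \<open>l\<close>
  shifted by two steps, and the shift costs two end terms, each at most the value at
  \<open>c\<close>, scaled by \<open>1 / 2 ^ n\<close>.\<close>

lemma upper_sum_eventually_less:
  fixes l :: "'a::cu_semigroup functional"
  assumes ab: "a \<lless> b" and bc: "b \<lless> c" and fin: "apply_functional l c < top" and "0 < \<eta>"
  shows "\<forall>\<^sub>F m in nhds l. upper_sum a b n m
    \<le> lower_sum a b n l + ennreal (1 / 2 ^ n) * (2 * apply_functional l c) + ennreal \<eta>"
proof -
  let ?N = "2 ^ n :: nat"
  \<comment> \<open>The chain is prolonged by \<open>c\<close> since the value at \<open>b\<close> can only be controlled by that at some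
    element way above \<open>b\<close>.\<close>
  define \<tau> where "\<tau> i = (if i \<le> ?N then dyadic_chain a b n i else c)" for i
  have chain: "\<tau> (Suc i) \<lless> \<tau> (Suc (Suc i))" if "i < ?N" for i
  proof (cases "Suc i = ?N")
    case True
    then show ?thesis
      using bc dyadic_chain_top[of a b n] by (simp add: \<tau>_def)
  next
    case False
    then show ?thesis
      using that dyadic_chain_way_below[OF ab, of "Suc i" n] by (simp add: \<tau>_def)
  qed
  have le_c: "\<tau> i \<le> c" for i
    using order_trans[OF dyadic_chain_le_top[OF ab, of i n] way_below_le[OF bc]] by (simp add: \<tau>_def)
  let ?l = "apply_functional l"
  have "\<forall>\<^sub>F m in nhds l. \<forall>i\<in>{..<?N}. apply_functional m (\<tau> (Suc i)) < ?l (\<tau> (Suc (Suc i))) + ennreal \<eta>"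
  proof (rule eventually_ball_finite)
    show "\<forall>i\<in>{..<?N}. \<forall>\<^sub>F m in nhds l. apply_functional m (\<tau> (Suc i)) < ?l (\<tau> (Suc (Suc i))) + ennreal \<eta>"
    proof
      fix i assume "i \<in> {..<?N}"
      moreover have "?l (\<tau> (Suc (Suc i))) < top"
        using le_less_trans[OF apply_mono[OF le_c] fin] .
      then have "?l (\<tau> (Suc (Suc i))) < ?l (\<tau> (Suc (Suc i))) + ennreal \<eta>"
        using \<open>0 < \<eta>\<close> ennreal_add_left_cancel_less[of "?l (\<tau> (Suc (Suc i)))" 0 "ennreal \<eta>"] by auto
      ultimately show "\<forall>\<^sub>F m in nhds l. apply_functional m (\<tau> (Suc i)) < ?l (\<tau> (Suc (Suc i))) + ennreal \<eta>"
        by (intro eventually_apply_less[OF chain]) auto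
    qed
  qed simp
  then show ?thesis
  proof (rule eventually_mono)
    fix m :: "'a functional"
    assume m: "\<forall>i\<in>{..<?N}. apply_functional m (\<tau> (Suc i)) < ?l (\<tau> (Suc (Suc i))) + ennreal \<eta>"
    have "(\<Sum>i<?N. apply_functional m (dyadic_chain a b n (Suc i))) = (\<Sum>i<?N. apply_functional m (\<tau> (Suc i)))"
      by (intro sum.cong) (auto simp: \<tau>_def)
    also have "\<dots> \<le> (\<Sum>i<?N. ?l (\<tau> (Suc (Suc i))) + ennreal \<eta>)"
      using m by (intro sum_mono) (auto intro: less_imp_le)
    also have "\<dots> = (\<Sum>i<?N. ?l (\<tau> (Suc (Suc i)))) + of_nat ?N * ennreal \<eta>"
      by (simp add: sum.distrib)
    also have "\<dots> \<le> (\<Sum>i<?N. ?l (\<tau> i)) + 2 * ?l c + of_nat ?N * ennreal \<eta>"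
    proof (intro add_right_mono)
      have "(\<Sum>i<?N. ?l (\<tau> (Suc (Suc i)))) \<le> (\<Sum>i<?N. ?l (\<tau> (Suc (Suc i)))) + (?l (\<tau> 0) + ?l (\<tau> 1))"
        by simp
      also have "\<dots> = (\<Sum>i<?N. ?l (\<tau> i)) + (?l (\<tau> ?N) + ?l (\<tau> (Suc ?N)))"
        by (rule sum_shift_two)
      also have "\<dots> \<le> (\<Sum>i<?N. ?l (\<tau> i)) + (?l c + ?l c)"
        by (intro add_mono apply_mono le_c order_refl)
      finally show "(\<Sum>i<?N. ?l (\<tau> (Suc (Suc i)))) \<le> (\<Sum>i<?N. ?l (\<tau> i)) + 2 * ?l c"
        by (simp add: mult_2)
    qed
    also have "(\<Sum>i<?N. ?l (\<tau> i)) = (\<Sum>i<?N. ?l (dyadic_chain a b n i))"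
      by (intro sum.cong) (auto simp: \<tau>_def)
    finally have "upper_sum a b n m \<le> ennreal (1 / 2 ^ n) *
        ((\<Sum>i<?N. ?l (dyadic_chain a b n i)) + 2 * ?l c + of_nat ?N * ennreal \<eta>)"
      unfolding upper_sum_def by (intro mult_left_mono) auto
    also have "\<dots> = lower_sum a b n l + ennreal (1 / 2 ^ n) * (2 * ?l c) + ennreal \<eta>"
    proof -
      have "ennreal (1 / 2 ^ n) * (of_nat ?N * ennreal \<eta>) = ennreal \<eta>"
        using \<open>0 < \<eta>\<close> by (simp add: ennreal_of_nat_eq_real_of_nat flip: ennreal_mult mult.assoc)
      then show ?thesis
        by (simp only: distrib_left lower_sum_def)
    qed
    finally show "upper_sum a b n m
      \<le> lower_sum a b n l + ennreal (1 / 2 ^ n) * (2 * ?l c) + ennreal \<eta>" .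
  qed
qed

lemma lower_semicontinuous_eventually:
  assumes "lower_semicontinuous f" "a < f x"
  shows "\<forall>\<^sub>F y in nhds x. a < f y"
  using assms eventually_nhds_in_open[of "{y. a < f y}" x] by (simp add: lower_semicontinuous_def)

text \<open>The supremum of the lower sums is lower semicontinuous and stays below every upper sum,
  so the local bound on upper sums supplies upper semicontinuity.\<close>

lemma ex_continuous_between:
  fixes a b :: "'a::cu_semigroup"
  assumes ab: "a \<lless> b"
  shows "\<exists>f\<in>Lsc. (\<forall>l. apply_functional l a \<le> f l \<and> f l \<le> apply_functional l b) \<and>
    (\<forall>c l. b \<lless> c \<and> apply_functional l c < top \<longrightarrow> (f \<longlongrightarrow> f l) (nhds l))"
proof -
  define f where "f l = (SUP n. lower_sum a b n l)" for l
  have "incseq (lower_sum a b)"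
    by (intro incseq_SucI le_funI lower_sum_le_Suc ab)
  then have f: "f \<in> Lsc"
    unfolding f_def using lower_sum_in_Lsc by (intro Lsc_SUP)
  have f_le: "f l \<le> upper_sum a b n l" for l n
    unfolding f_def by (intro SUP_least lower_sum_le_upper_sum ab)
  have lower: "apply_functional l a \<le> f l" for l
    unfolding f_def by (rule SUP_upper2[of 0]) (auto simp: lower_sum_def)
  have upper: "f l \<le> apply_functional l b" for l
    using f_le[of l 0] by (simp add: upper_sum_def)
  have "(f \<longlongrightarrow> f l) (nhds l)" if bc: "b \<lless> c" and fin: "apply_functional l c < top" for c l
  proof (rule order_tendstoI)
    show "\<forall>\<^sub>F m in nhds l. x < f m" if "x < f l" for x
      using lower_semicontinuous_eventually[OF Lsc_lower_semicontinuous[OF f] that] .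
    fix x assume "f l < x"
    then obtain y where y: "f l < y" "y < x"
      using dense by blast
    have "y < top"
      using y(2) top_greatest by (rule less_le_trans)
    then obtain r \<phi> where r: "y = ennreal r" "0 \<le> r" and \<phi>: "f l = ennreal \<phi>" "0 \<le> \<phi>" "\<phi> < r"
      using y(1) by (cases y; cases "f l") (auto simp: ennreal_less_iff)
    obtain \<gamma> where \<gamma>: "apply_functional l c = ennreal \<gamma>" "0 \<le> \<gamma>"
      using fin by (cases "apply_functional l c") auto
    \<comment> \<open>Half the gap, because two errors must fit: the end terms of the shift and the
      local perturbation.\<close>
    define \<eta> where "\<eta> = (r - \<phi>) / 2"
    have "0 < \<eta>"
      using \<phi> by (simp add: \<eta>_def)
    \<comment> \<open>Makes the end terms at most \<open>\<eta>\<close>; the summand 1 keeps the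
      denominator positive when \<open>\<gamma> = 0\<close>.\<close>
    obtain n where n: "(1 / 2) ^ n < \<eta> / (2 * \<gamma> + 1)"
      using real_arch_pow_inv[of "\<eta> / (2 * \<gamma> + 1)" "1 / 2"] \<open>0 < \<eta>\<close> \<gamma> by auto
    then have "(1 / 2) ^ n * (2 * \<gamma> + 1) < \<eta>"
      using \<gamma> by (simp add: field_simps)
    moreover have "(1 / 2) ^ n * (2 * \<gamma>) \<le> (1 / 2) ^ n * (2 * \<gamma> + 1 :: real)"
      by (intro mult_left_mono) auto
    ultimately have n': "1 / 2 ^ n * (2 * \<gamma>) \<le> \<eta>"
      by (simp add: power_one_over)
    have "lower_sum a b n l + ennreal (1 / 2 ^ n) * (2 * apply_functional l c) + ennreal \<eta> \<le> y"
    proof -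
      have "lower_sum a b n l \<le> ennreal \<phi>"
        unfolding \<phi>(1)[symmetric] f_def by (intro SUP_upper) auto
      moreover have "ennreal (1 / 2 ^ n) * (2 * apply_functional l c) \<le> ennreal \<eta>"
      proof -
        have "2 * ennreal \<gamma> = ennreal (2 * \<gamma>)"
          using \<gamma>(2) by (simp add: ennreal_mult)
        then have "ennreal (1 / 2 ^ n) * (2 * apply_functional l c) = ennreal (1 / 2 ^ n * (2 * \<gamma>))"
          using \<gamma> by (simp only: \<gamma>(1)) (simp flip: ennreal_mult)
        then show ?thesis
          using n' by (simp add: ennreal_leI)
      qed
      ultimately have "lower_sum a b n l + ennreal (1 / 2 ^ n) * (2 * apply_functional l c) + ennreal \<eta>
          \<le> ennreal \<phi> + ennreal \<eta> + ennreal \<eta>"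
        by (intro add_mono) auto
      also have "\<dots> = y"
        using \<phi> \<open>0 < \<eta>\<close> r by (simp add: \<eta>_def flip: ennreal_plus)
      finally show ?thesis .
    qed
    then have "f m < x" if "upper_sum a b n m
        \<le> lower_sum a b n l + ennreal (1 / 2 ^ n) * (2 * apply_functional l c) + ennreal \<eta>" for m
      using order_trans[OF f_le that] y(2) by (meson le_less_trans order_trans)
    with upper_sum_eventually_less[OF ab bc fin \<open>0 < \<eta>\<close>]
    show "\<forall>\<^sub>F m in nhds l. f m < x"
      by (rule eventually_mono)
  qed
  then show ?thesis
    using f lower upper by blast
qed

section \<open>From multiples of elements to L(F(S))\<close>

lemma strongly_below_le:
  assumes "f \<lhd> g"
  shows "f l \<le> g l"
proof -
  obtain \<epsilon> :: real where "0 < \<epsilon>" "f l \<le> ennreal (1 - \<epsilon>) * g l"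
    using assms unfolding strongly_below_def by blast
  moreover have "ennreal (1 - \<epsilon>) * g l \<le> 1 * g l"
    using \<open>0 < \<epsilon>\<close> by (intro mult_right_mono) auto
  ultimately show ?thesis
    by simp
qed

lemma strongly_below_le_trans:
  assumes "f \<lhd> g" and le: "\<And>l. g l \<le> h l"
  shows "f \<lhd> h"
proof -
  obtain \<epsilon> :: real where \<epsilon>: "0 < \<epsilon>" "\<epsilon> < 1" "\<And>l. f l \<le> ennreal (1 - \<epsilon>) * g l"
    and cont: "\<And>l. g l < \<infinity> \<Longrightarrow> (f \<longlongrightarrow> f l) (nhds l)"
    using assms unfolding strongly_below_def by blast
  have "f l \<le> ennreal (1 - \<epsilon>) * h l" for l
    using \<epsilon>(3)[of l] mult_left_mono[OF le, of "ennreal (1 - \<epsilon>)" l] by (meson order_trans zero_le)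
  then show ?thesis
    unfolding strongly_below_def using \<epsilon> cont le by (meson le_less_trans)
qed

text \<open>A continuous \<open>f n\<close> is placed between every other pair of neighbours in a
  rapid sequence for \<open>s\<close>; the pairs skipped in between relate finiteness of
  \<open>f (Suc n)\<close> to continuity of \<open>f n\<close>. Factors increasing to 1 supply the
  strictness.\<close>

lemma scaled_hat_in_L_F:
  fixes s :: "'a::cu_semigroup"
  assumes "0 < c"
  shows "(\<lambda>l. ennreal c * hat s l) \<in> L_F"
proof -
  obtain x where x: "incseq x" "\<And>n. x n \<lless> x (Suc n)" "has_sup x s" "\<And>n. x n \<lless> s"
    using rapid_sequence[of s] by auto
  have "\<forall>n. \<exists>f\<in>Lsc. (\<forall>l. apply_functional l (x (2 * n)) \<le> f l \<and> f l \<le> apply_functional l (x (Suc (2 * n)))) \<and>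
    (\<forall>c l. x (Suc (2 * n)) \<lless> c \<and> apply_functional l c < top \<longrightarrow> (f \<longlongrightarrow> f l) (nhds l))"
    using ex_continuous_between[OF x(2)] by blast
  then obtain f where f: "\<And>n. f n \<in> Lsc"
    "\<And>n l. apply_functional l (x (2 * n)) \<le> f n l" "\<And>n l. f n l \<le> apply_functional l (x (Suc (2 * n)))"
    and cont: "\<And>n c l. x (Suc (2 * n)) \<lless> c \<Longrightarrow> apply_functional l c < top \<Longrightarrow> (f n \<longlongrightarrow> f n l) (nhds l)"
    by metis
  \<comment> \<open>Strictly increasing to 1; the shift by 2 makes already \<open>\<kappa> 0\<close>
    positive.\<close>
  define \<kappa> :: "nat \<Rightarrow> real" where "\<kappa> n = 1 - 1 / real (n + 2)" for n
  have \<kappa>: "0 < \<kappa> n" "\<kappa> n < \<kappa> (Suc n)" for n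
    by (auto simp: \<kappa>_def field_simps)
  define g where "g n l = ennreal (c * \<kappa> n) * f n l" for n l
  have f_le: "f n l \<le> f (Suc n) l" for n l
    using order_trans[OF f(3)[of n l] order_trans[OF apply_mono f(2)[of l "Suc n"]]] x(1)
    by (simp add: incseq_def)
  have g: "g n \<in> Lsc" for n
    unfolding g_def using f(1) \<kappa>(1)[of n] assms by (intro Lsc_cmult) auto
  have below: "g n \<lhd> g (Suc n)" for n
    unfolding strongly_below_def
  proof (intro conjI exI[of _ "1 - \<kappa> n / \<kappa> (Suc n)"] allI impI)
    show "0 < 1 - \<kappa> n / \<kappa> (Suc n)" "1 - \<kappa> n / \<kappa> (Suc n) < 1"
      using \<kappa>[of n] \<kappa>(1)[of "Suc n"] by (auto simp: field_simps)
    show "g n l \<le> ennreal (1 - (1 - \<kappa> n / \<kappa> (Suc n))) * g (Suc n) l" for l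
    proof -
      have "ennreal (1 - (1 - \<kappa> n / \<kappa> (Suc n))) * g (Suc n) l = ennreal (c * \<kappa> n) * f (Suc n) l"
        using \<kappa>(1)[of n] \<kappa>(1)[of "Suc n"] assms unfolding g_def
        by (subst mult.assoc[symmetric], subst ennreal_mult[symmetric]) (auto simp: mult.commute)
      then show ?thesis
        by (simp add: g_def f_le mult_left_mono)
    qed
    show "(g n \<longlongrightarrow> g n l) (nhds l)" if "g (Suc n) l < \<infinity>" for l
    proof -
      \<comment> \<open>\<open>f (Suc n)\<close> dominates the value at
        \<open>x (2 * n + 2)\<close>, which is way above the upper bound
        \<open>x (2 * n + 1)\<close> of \<open>f n\<close>, so \<open>cont\<close> applies.\<close>
      have "f (Suc n) l < top"
        using that \<kappa>(1)[of "Suc n"] assms by (auto simp: g_def ennreal_mult_less_top)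
      then have "apply_functional l (x (2 * Suc n)) < top"
        by (rule le_less_trans[OF f(2)])
      then have "(f n \<longlongrightarrow> f n l) (nhds l)"
        using x(2)[of "Suc (2 * n)"] by (intro cont) auto
      then show ?thesis
        unfolding g_def by (intro ennreal_tendsto_cmult) auto
    qed
  qed
  have "incseq g"
    by (intro incseq_SucI le_funI strongly_below_le below)
  moreover have "ennreal c * hat s l = (SUP n. g n l)" for l
  proof -
    have "hat s l = (SUP n. f n l)"
    proof (rule antisym)
      have "apply_functional l (x n) \<le> f n l" for n
        using order_trans[OF apply_mono f(2)[of l n]] x(1) by (simp add: incseq_def)
      then show "hat s l \<le> (SUP n. f n l)"
        unfolding hat_def apply_has_sup[OF x(1,3)] by (intro SUP_mono) auto
      show "(SUP n. f n l) \<le> hat s l"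
        unfolding hat_def using x(4)
        by (intro SUP_least order_trans[OF f(3)] apply_mono way_below_le)
    qed
    moreover have "incseq (\<lambda>n. f n l)"
      using f_le by (intro incseq_SucI)
    ultimately have lim: "(\<lambda>n. f n l) \<longlonglongrightarrow> hat s l"
      using LIMSEQ_SUP by metis
    have "(\<lambda>n. c * \<kappa> n) \<longlonglongrightarrow> c * (1 - 0)"
      unfolding \<kappa>_def
      by (intro tendsto_intros LIMSEQ_ignore_initial_segment[where f = "\<lambda>n. 1 / real n"] lim_1_over_n)
    then have "(\<lambda>n. ennreal (c * \<kappa> n)) \<longlonglongrightarrow> ennreal c"
      by (intro tendsto_ennrealI) simp
    then have "(\<lambda>n. g n l) \<longlonglongrightarrow> ennreal c * hat s l"
      unfolding g_def using lim assms by (intro tendsto_mult_ennreal) auto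
    moreover have "incseq (\<lambda>n. g n l)"
      using \<open>incseq g\<close> by (simp add: incseq_def le_fun_def)
    ultimately show ?thesis
      using LIMSEQ_SUP LIMSEQ_unique by blast
  qed
  moreover have "(\<lambda>l. ennreal c * hat s l) \<in> Lsc"
    using assms by (intro Lsc_cmult hat_in_Lsc) auto
  ultimately show ?thesis
    unfolding L_F_def using g below by blast
qed

text \<open>A diagonal sequence: the member chosen in row \<open>Suc k\<close> lies strongly above
  the previous choice and above all \<open>g i j\<close> with \<open>i, j \<le> k\<close>, so the
  chosen members have the same supremum as the whole array.\<close>

lemma SUP_in_L_F:
  fixes f :: "nat \<Rightarrow> 'a::cu_semigroup functional \<Rightarrow> ennreal"
  assumes f: "\<And>i. f i \<in> L_F" and "incseq f"
  shows "(\<lambda>l. SUP i. f i l) \<in> L_F"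
proof -
  have "\<forall>i. \<exists>g. (\<forall>n. g n \<in> Lsc) \<and> incseq g \<and> (\<forall>n. g n \<lhd> g (Suc n)) \<and> (\<forall>l. f i l = (SUP n. g n l))"
    using f unfolding L_F_def by blast
  then obtain g where g: "\<And>i n. g i n \<in> Lsc" "\<And>i. incseq (g i)" "\<And>i n. g i n \<lhd> g i (Suc n)"
    and f_eq: "\<And>i l. f i l = (SUP n. g i n l)"
    by metis
  have g_le_f: "g i n l \<le> f i l" for i n l
    unfolding f_eq by (intro SUP_upper) auto
  have ev: "\<forall>\<^sub>F n in sequentially. g i j \<lhd> g k n" if "i \<le> k" for i j k
  proof -
    have "f i \<le> f k"
      using \<open>incseq f\<close> that by (simp add: incseqD)
    \<comment> \<open>Compactness only returns \<open>\<le>\<close>. Starting one index further in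
      row \<open>i\<close> recovers the strong relation from
      \<open>g i j \<lhd> g i (Suc j)\<close>.\<close>
    have "g i (Suc j) \<lhd> f k"
    proof (rule strongly_below_le_trans[OF g(3)])
      show "g i (Suc (Suc j)) l \<le> f k l" for l
        using g_le_f \<open>f i \<le> f k\<close> by (meson le_funD order_trans)
    qed
    moreover have "f k = (\<lambda>l. SUP n. g k n l)"
      by (simp add: f_eq fun_eq_iff)
    ultimately have "\<forall>\<^sub>F n in sequentially. \<forall>l. g i (Suc j) l \<le> g k n l"
      using g by (intro strongly_below_SUP) auto
    then show ?thesis
      by (rule eventually_mono) (auto intro: strongly_below_le_trans[OF g(3)])
  qed
  have "\<exists>n'. g k n \<lhd> g (Suc k) n' \<and> (\<forall>i\<in>{..k}. \<forall>j\<in>{..k}. g i j \<lhd> g (Suc k) n')" for k n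
  proof -
    have "\<forall>\<^sub>F n' in sequentially. g k n \<lhd> g (Suc k) n' \<and> (\<forall>i\<in>{..k}. \<forall>j\<in>{..k}. g i j \<lhd> g (Suc k) n')"
      by (intro eventually_conj eventually_ball_finite ballI ev) auto
    then show ?thesis
      by (rule eventually_happens'[rotated]) simp
  qed
  then obtain N where "\<forall>k. g k (N k) \<lhd> g (Suc k) (N (Suc k)) \<and>
      (\<forall>i\<in>{..k}. \<forall>j\<in>{..k}. g i j \<lhd> g (Suc k) (N (Suc k)))"
    using dependent_nat_choice[of "\<lambda>_ _. True"
      "\<lambda>k n n'. g k n \<lhd> g (Suc k) n' \<and> (\<forall>i\<in>{..k}. \<forall>j\<in>{..k}. g i j \<lhd> g (Suc k) n')"]
    by auto
  then have N: "\<And>k. g k (N k) \<lhd> g (Suc k) (N (Suc k))"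
    "\<And>k i j. i \<le> k \<Longrightarrow> j \<le> k \<Longrightarrow> g i j \<lhd> g (Suc k) (N (Suc k))"
    by auto
  define h where "h k = g k (N k)" for k
  have "incseq h"
    by (intro incseq_SucI le_funI strongly_below_le) (simp add: h_def N)
  moreover have "(SUP i. f i l) = (SUP k. h k l)" for l
  proof (rule antisym)
    show "(SUP k. h k l) \<le> (SUP i. f i l)"
      unfolding h_def by (intro SUP_mono) (auto intro: g_le_f)
    have "g i j l \<le> (SUP k. h k l)" for i j
    proof -
      have "g i j l \<le> h (Suc (max i j)) l"
        unfolding h_def by (intro strongly_below_le N(2)) auto
      also have "\<dots> \<le> (SUP k. h k l)"
        by (intro SUP_upper) auto
      finally show ?thesis .
    qed
    then show "(SUP i. f i l) \<le> (SUP k. h k l)"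
      unfolding f_eq by (intro SUP_least)
  qed
  moreover have "(\<lambda>l. SUP i. f i l) \<in> Lsc"
    using f \<open>incseq f\<close> by (intro Lsc_SUP) (auto simp: L_F_def)
  moreover have "h k \<in> Lsc" "h k \<lhd> h (Suc k)" for k
    by (simp_all add: h_def g N)
  ultimately show ?thesis
    unfolding L_F_def by blast
qed

lemma S_R_subset_L_F: "(S_R :: ('a::cu_semigroup functional \<Rightarrow> ennreal) set) \<subseteq> L_F"
proof
  fix f :: "'a functional \<Rightarrow> ennreal" assume "f \<in> S_R"
  then obtain s n where n: "\<And>i::nat. 0 < n i"
    and inc: "incseq (\<lambda>i l. hat (s i) l / of_nat (n i))"
    and f: "\<And>l. f l = (SUP i. hat (s i) l / of_nat (n i))"
    unfolding S_R_def by blast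
  have "(\<lambda>l. hat (s i) l / of_nat (n i)) \<in> L_F" for i
    using scaled_hat_in_L_F[of "1 / real (n i)" "s i"] n by (simp add: divide_of_nat_ennreal)
  then have "(\<lambda>l. SUP i. hat (s i) l / of_nat (n i)) \<in> L_F"
    using inc by (intro SUP_in_L_F)
  then show "f \<in> L_F"
    by (simp add: f[abs_def])
qed

theorem theorem3p2p1:
  shows "(S_R :: ('a::cu_semigroup functional \<Rightarrow> ennreal) set) = L_F"
  using S_R_subset_L_F L_F_subset_S_R by (rule antisym)

end
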